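(* Let $\Omega$ be an associative $\mathbb{C}$-algebra of finite or countable dimension (possibly not unital) and let $d\ge1$ be an integer. The additive group $\mathbb{C}$ acts on the algebra $Y_d(\Omega)$ by automorphisms $\mathrm{Shift}_c$, $c\in\mathbb{C}$, such that $$\mathrm{Shift}_c\colon t_{ij}(\mathbf{x};s)\mapsto t_{ij}(\mathbf{x};s+c)$$ for any $i,j\in\{1,\dots,d\}$, $\mathbf{x}\in W(\Omega)$, and $s\in\mathbb{C}$.
   Context: The Lie algebra $\mathfrak{gl}(N,\Omega)=\mathrm{Mat}(N,\mathbb{C})\otimes\Omega$ carries the commutator bracket; with $E_{ij}$ the matrix units ($1\le i,j\le N$) and $E_{ij}(x):=E_{ij}\otimes x$, one has $[E_{ij}(x),E_{kl}(y)]=\delta_{kj}E_{il}(xy)-\delta_{il}E_{kj}(yx)$. The Lie algebra $\mathfrak{gl}(N,\mathbb{C})$ acts on $\mathfrak{gl}(N,\Omega)=\mathfrak{gl}(N,\mathbb{C})\otimes\Omega$ by $\mathrm{ad}\otimes\mathrm{Id}$, i.e. $[E_{ij},E_{kl}(y)]=\delta_{kj}E_{il}(y)-\delta_{il}E_{kj}(y)$ (even if $\Omega$ is not unital); this action is by derivations and extends to the universal enveloping algebra $\mathcal{U}(\mathfrak{gl}(N,\Omega))$ by derivations. By convention $\mathcal{U}(\mathfrak{gl}(0,\Omega))=\mathbb{C}$. For $0\le d\le N$ let $\mathfrak{gl}_d(N,\mathbb{C})\subset\mathfrak{gl}(N,\mathbb{C})$ be the span of the $E_{ij}$ with $d+1\le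 i,j\le N$, and let $A_d(\Omega;N):=\mathcal{U}(\mathfrak{gl}(N,\Omega))^{\mathfrak{gl}_d(N,\mathbb{C})}$ be the subalgebra of invariants. Let $I^+(N)$ be the left ideal of $\mathcal{U}(\mathfrak{gl}(N,\Omega))$ generated by all $E_{iN}(x)$, $1\le i\le N$, $x\in\Omega$, and $I^-(N)$ the right ideal generated by all $E_{Nj}(x)$, $1\le j\le N$, $x\in\Omega$. Let $\mathcal{U}(\mathfrak{gl}(N,\Omega))^{E_{NN}}$ be the subalgebra of elements annihilated by $[E_{NN},-]$. Its intersections with $I^+(N)$ and $I^-(N)$ coincide; the common intersection $L(N)$ is a two-sided ideal in it, and $\mathcal{U}(\mathfrak{gl}(N,\Omega))^{E_{NN}}=\mathcal{U}(\mathfrak{gl}(N-1,\Omega))\oplus L(N)$. Let $\pi_{N,N-1}\colon\mathcal{U}(\mathfrak{gl}(N,\Omega))^{E_{NN}}\to\mathcal{U}(\mathfrak{gl}(N-1,\Omega))$ be the projection along $L(N)$; it is a homomorphism of filtered algebras, and for $N>d$ it maps $A_d(\Omega;N)$ into $A_d(\Omega;N-1)$. $A_d(\Omega):=\varprojlim(A_d(\Omega;N),\pi_{N,N-1})$, the limit taken in the category of filtered algebras with respect to the canonical filtrations of universal enveloping algebras: its elements are sequences $\mathbf{a}=\{\mathbf{a}(N)\colon N\ge d\}$ with $\mathbf{a}(N)\in A_d(\Omega;N)$, $\pi_{N,N-1}(\mathbf{a}(N))=\mathbf{a}(N-1)$ for $N>d$, and $\deg\mathbf{a}(N)$ bounded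 uniformly in $N$. Let $\pi_{\infty,N}\colon A_d(\Omega)\to A_d(\Omega;N)$, $\mathbf{a}\mapsto\mathbf{a}(N)$. Let $W(\Omega):=\bigsqcup_{m\ge1}\Omega^m$ (ordered tuples of elements of $\Omega$), and $\ell(\mathbf{x}):=m$ for $\mathbf{x}\in\Omega^m$. For $\mathbf{x}=(x_1,\dots,x_m)$ and $N\ge\max(i,j)$ put $e_{ij}(\mathbf{x};N):=\sum_{a_1,\dots,a_{m-1}=1}^N E_{ia_1}(x_1)E_{a_1a_2}(x_2)\cdots E_{a_{m-1}j}(x_m)$ (equal to $E_{ij}(x_1)$ if $m=1$). $\mathrm{Comp}(m)$ is the set of compositions $\nu=(\nu_1,\dots,\nu_n)$ of $m$ (positive integers with sum $m$). For $\mathbf{x}\in\Omega^m$ and $\nu\in\mathrm{Comp}(m)$ of length $n$, $\mathbf{x}\rhd\nu:=(y_1,\dots,y_n)\in\Omega^n$, where $y_1=x_1\cdots x_{\nu_1}$, $y_2=x_{\nu_1+1}\cdots x_{\nu_1+\nu_2}$, ..., $y_n=x_{\nu_1+\dots+\nu_{n-1}+1}\cdots x_m$ (products in $\Omega$). For $s\in\mathbb{C}$ and $\mathbf{x}\in\Omega^m$, $$t_{ij}(\mathbf{x};N;s):=\sum_{\nu\in\mathrm{Comp}(m)}(-N-s)^{\ell(\mathbf{x})-\ell(\mathbf{x}\rhd\nu)}e_{ij}(\mathbf{x}\rhd\nu;N),\qquad 0^0:=1.$$ For $i,j\in\{1,\dots,d\}$ there is a unique element $t_{ij}(\mathbf{x};s)\in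 A_d(\Omega)$ with $\pi_{\infty,N}(t_{ij}(\mathbf{x};s))=t_{ij}(\mathbf{x};N;s)$ for all $N\ge d$. For $d\ge1$, $Y_d(\Omega)$ is the unital subalgebra of $A_d(\Omega)$ generated by all $t_{ij}(\mathbf{x};s)$ with $i,j\in\{1,\dots,d\}$, $\mathbf{x}\in W(\Omega)$, where $s\in\mathbb{C}$ is an arbitrary fixed number (the subalgebra does not depend on the choice of $s$). *)

theory Defs
  imports Complex_Main "HOL-Library.Countable_Set" "HOL-Library.Function_Algebras"
    "HOL-Library.Poly_Mapping" "HOL-Algebra.QuotRing" "HOL-Algebra.Module"
    "HOL-Algebra.Group_Action"
begin

text \<open>Associative complex algebras, not assumed unital.  Class \<open>ring\<close> has no unit.\<close>

locale complex_algebra = vector_space scale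
  for scale :: "complex \<Rightarrow> 'w::ring \<Rightarrow> 'w" +
  assumes scale_mult_left: "scale c (x * y) = scale c x * y"
    and scale_mult_right: "scale c (x * y) = x * scale c y"


section \<open>Records of complex algebras\<close>

text \<open>
  Unital complex algebras given by a carrier are represented by the record type
  \<open>(complex, 'a) module\<close> of HOL-Algebra, that is a ring record together with a
  scalar multiplication.  (The locales \<open>module\<close> and \<open>algebra\<close> of HOL-Algebra are
  not used, since they demand commutativity.)
\<close>

definition quot_algebra :: "('c, 'a) module \<Rightarrow> 'a set \<Rightarrow> ('c, 'a set) module" where
  "quot_algebra R I =
    \<lparr>carrier = carrier (R Quot I), mult = mult (R Quot I), one = one (R Quot I),
     zero = zero (R Quot I), add = add (R Quot I),
     smult = (\<lambda>c X. \<Union>x\<in>X. I +>\<^bsub>R\<^esub> (c \<odot>\<^bsub>R\<^esub> x))\<rparr>"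

definition list_prod :: "('a, 'm) monoid_scheme \<Rightarrow> 'a list \<Rightarrow> 'a" where
  "list_prod R as = foldr (mult R) as \<one>\<^bsub>R\<^esub>"

inductive_set lin_span :: "('c, 'a) module \<Rightarrow> 'a set \<Rightarrow> 'a set"
  for R :: "('c, 'a) module" and S :: "'a set" where
  zero: "\<zero>\<^bsub>R\<^esub> \<in> lin_span R S"
| base: "a \<in> S \<Longrightarrow> a \<in> lin_span R S"
| add: "a \<in> lin_span R S \<Longrightarrow> b \<in> lin_span R S \<Longrightarrow> a \<oplus>\<^bsub>R\<^esub> b \<in> lin_span R S"
| smult: "a \<in> lin_span R S \<Longrightarrow> c \<odot>\<^bsub>R\<^esub> a \<in> lin_span R S"

inductive_set generate_algebra :: "('c, 'a) module \<Rightarrow> 'a set \<Rightarrow> 'a set"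
  for R :: "('c, 'a) module" and S :: "'a set" where
  one: "\<one>\<^bsub>R\<^esub> \<in> generate_algebra R S"
| incl: "a \<in> S \<Longrightarrow> a \<in> generate_algebra R S"
| add: "a \<in> generate_algebra R S \<Longrightarrow> b \<in> generate_algebra R S
    \<Longrightarrow> a \<oplus>\<^bsub>R\<^esub> b \<in> generate_algebra R S"
| mult: "a \<in> generate_algebra R S \<Longrightarrow> b \<in> generate_algebra R S
    \<Longrightarrow> a \<otimes>\<^bsub>R\<^esub> b \<in> generate_algebra R S"
| smult: "a \<in> generate_algebra R S \<Longrightarrow> c \<odot>\<^bsub>R\<^esub> a \<in> generate_algebra R S"

definition left_ideal_gen :: "('a, 'm) ring_scheme \<Rightarrow> 'a set \<Rightarrow> 'a set" where
  "left_ideal_gen R S =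
    \<Inter>{I. additive_subgroup I R \<and> (\<forall>r\<in>carrier R. \<forall>a\<in>I. r \<otimes>\<^bsub>R\<^esub> a \<in> I) \<and> S \<subseteq> I}"

definition right_ideal_gen :: "('a, 'm) ring_scheme \<Rightarrow> 'a set \<Rightarrow> 'a set" where
  "right_ideal_gen R S =
    \<Inter>{I. additive_subgroup I R \<and> (\<forall>r\<in>carrier R. \<forall>a\<in>I. a \<otimes>\<^bsub>R\<^esub> r \<in> I) \<and> S \<subseteq> I}"

definition algebra_derivation :: "('c, 'a) module \<Rightarrow> ('a \<Rightarrow> 'a) \<Rightarrow> bool" where
  "algebra_derivation R D \<longleftrightarrow>
    D \<in> extensional (carrier R) \<and>
    (\<forall>a\<in>carrier R. D a \<in> carrier R) \<and>
    (\<forall>a\<in>carrier R. \<forall>b\<in>carrier R. D (a \<oplus>\<^bsub>R\<^esub> b) = D a \<oplus>\<^bsub>R\<^esub> D b) \<and>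
    (\<forall>c. \<forall>a\<in>carrier R. D (c \<odot>\<^bsub>R\<^esub> a) = c \<odot>\<^bsub>R\<^esub> D a) \<and>
    (\<forall>a\<in>carrier R. \<forall>b\<in>carrier R.
      D (a \<otimes>\<^bsub>R\<^esub> b) = (D a \<otimes>\<^bsub>R\<^esub> b) \<oplus>\<^bsub>R\<^esub> (a \<otimes>\<^bsub>R\<^esub> D b))"

definition algebra_auto :: "('c, 'a) module \<Rightarrow> ('a \<Rightarrow> 'a) set" where
  "algebra_auto R =
    {f \<in> ring_iso R R. \<forall>c. \<forall>a\<in>carrier R. f (c \<odot>\<^bsub>R\<^esub> a) = c \<odot>\<^bsub>R\<^esub> f a}"


section \<open>Universal enveloping algebras\<close>

datatype 'g word = Word (letters: "'g list")

instantiation word :: (type) monoid_add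
begin

definition zero_word :: "'g word" where
  "zero_word = Word []"

definition plus_word :: "'g word \<Rightarrow> 'g word \<Rightarrow> 'g word" where
  "plus_word u v = Word (letters u @ letters v)"

instance
  by standard (simp_all add: zero_word_def plus_word_def)

end

text \<open>
  By the instance above, \<open>'g word \<Rightarrow>\<^sub>0 complex\<close> is the free unital complex algebra
  on the set of all elements of \<open>'g\<close>; \<open>free_alg G\<close> is the one on the letters in \<open>G\<close>.
\<close>

definition free_alg :: "'g set \<Rightarrow> (complex, 'g word \<Rightarrow>\<^sub>0 complex) module" where
  "free_alg G =
    \<lparr>carrier = {p. \<forall>w\<in>Poly_Mapping.keys p. set (letters w) \<subseteq> G},
     mult = (*), one = 1, zero = 0, add = (+),
     smult = (\<lambda>c p. Poly_Mapping.single 0 c * p)\<rparr>"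

definition letter :: "'g \<Rightarrow> 'g word \<Rightarrow>\<^sub>0 complex" where
  "letter x = Poly_Mapping.single (Word [x]) 1"

text \<open>
  For a complex Lie algebra with carrier \<open>G\<close>, scalar multiplication \<open>sc\<close> and bracket \<open>br\<close>:
  the first two families of relations turn the free algebra into the tensor algebra.
\<close>

definition uea_relations ::
  "('g::ab_group_add) set \<Rightarrow> (complex \<Rightarrow> 'g \<Rightarrow> 'g) \<Rightarrow> ('g \<Rightarrow> 'g \<Rightarrow> 'g)
    \<Rightarrow> ('g word \<Rightarrow>\<^sub>0 complex) set" where
  "uea_relations G sc br =
    {letter (x + y) - (letter x + letter y) | x y. x \<in> G \<and> y \<in> G} \<union>
    {letter (sc c x) - Poly_Mapping.single 0 c * letter x | c x. x \<in> G} \<union>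
    {letter x * letter y - letter y * letter x - letter (br x y) | x y. x \<in> G \<and> y \<in> G}"

definition uea_ideal ::
  "('g::ab_group_add) set \<Rightarrow> (complex \<Rightarrow> 'g \<Rightarrow> 'g) \<Rightarrow> ('g \<Rightarrow> 'g \<Rightarrow> 'g)
    \<Rightarrow> ('g word \<Rightarrow>\<^sub>0 complex) set" where
  "uea_ideal G sc br = Idl\<^bsub>free_alg G\<^esub> (uea_relations G sc br)"

definition uea ::
  "('g::ab_group_add) set \<Rightarrow> (complex \<Rightarrow> 'g \<Rightarrow> 'g) \<Rightarrow> ('g \<Rightarrow> 'g \<Rightarrow> 'g)
    \<Rightarrow> (complex, ('g word \<Rightarrow>\<^sub>0 complex) set) module" where
  "uea G sc br = quot_algebra (free_alg G) (uea_ideal G sc br)"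


section \<open>The Lie algebra of matrices over the algebra\<close>

text \<open>
  \<open>N \<times> N\<close> matrices are represented by functions vanishing outside \<open>{1..N} \<times> {1..N}\<close>, so
  that the inclusion of matrices of size \<open>N - 1\<close> into matrices of size \<open>N\<close> (padding by
  zeros) is an inclusion of sets.  Addition is pointwise (\<open>Function_Algebras\<close>).
\<close>

type_synonym 'w mat = "nat \<Rightarrow> nat \<Rightarrow> 'w"

type_synonym 'w U_elem = "('w mat word \<Rightarrow>\<^sub>0 complex) set"

definition gl :: "nat \<Rightarrow> ('w::ring) mat set" where
  "gl N = {A. \<forall>i j. i \<notin> {1..N} \<or> j \<notin> {1..N} \<longrightarrow> A i j = 0}"

definition gl_scale :: "(complex \<Rightarrow> 'w \<Rightarrow> 'w) \<Rightarrow> complex \<Rightarrow> 'w mat \<Rightarrow> 'w mat" where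
  "gl_scale scale c A = (\<lambda>i j. scale c (A i j))"

definition gl_bracket :: "nat \<Rightarrow> ('w::ring) mat \<Rightarrow> 'w mat \<Rightarrow> 'w mat" where
  "gl_bracket N A B = (\<lambda>i j. \<Sum>k = 1..N. A i k * B k j - B i k * A k j)"

definition mat_unit :: "nat \<Rightarrow> nat \<Rightarrow> 'w::zero \<Rightarrow> 'w mat" where
  "mat_unit i j x = (\<lambda>k l. if k = i \<and> l = j then x else 0)"

text \<open>The action \<open>ad \<otimes> Id\<close> of complex matrices on matrices over the algebra.\<close>

definition gl_act ::
  "(complex \<Rightarrow> 'w \<Rightarrow> 'w) \<Rightarrow> nat \<Rightarrow> complex mat \<Rightarrow> ('w::ring) mat \<Rightarrow> 'w mat" where
  "gl_act scale N X A =
    (\<lambda>i j. \<Sum>k = 1..N. scale (X i k) (A k j) - scale (X k j) (A i k))"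

definition U :: "(complex \<Rightarrow> 'w \<Rightarrow> 'w) \<Rightarrow> nat \<Rightarrow> (complex, ('w::ring) U_elem) module" where
  "U scale N = uea (gl N) (gl_scale scale) (gl_bracket N)"

definition U_ideal :: "(complex \<Rightarrow> 'w \<Rightarrow> 'w) \<Rightarrow> nat \<Rightarrow> ('w::ring) U_elem" where
  "U_ideal scale N = uea_ideal (gl N) (gl_scale scale) (gl_bracket N)"

text \<open>The canonical map from the Lie algebra to its universal enveloping algebra.\<close>

definition U_of :: "(complex \<Rightarrow> 'w \<Rightarrow> 'w) \<Rightarrow> nat \<Rightarrow> ('w::ring) mat \<Rightarrow> 'w U_elem" where
  "U_of scale N A = U_ideal scale N +>\<^bsub>free_alg (gl N)\<^esub> letter A"

definition E ::
  "(complex \<Rightarrow> 'w \<Rightarrow> 'w) \<Rightarrow> nat \<Rightarrow> nat \<Rightarrow> nat \<Rightarrow> 'w \<Rightarrow> ('w::ring) U_elem" where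
  "E scale N i j x = U_of scale N (mat_unit i j x)"

definition U_filtration ::
  "(complex \<Rightarrow> 'w \<Rightarrow> 'w) \<Rightarrow> nat \<Rightarrow> nat \<Rightarrow> ('w::ring) U_elem set" where
  "U_filtration scale N n =
    lin_span (U scale N)
      {list_prod (U scale N) (map (U_of scale N) As) | As. set As \<subseteq> gl N \<and> length As \<le> n}"

text \<open>
  The canonical homomorphism from level \<open>N - 1\<close> to level \<open>N\<close>, induced by the inclusion of
  the Lie algebras; all the sets united below coincide.
\<close>

definition U_incl ::
  "(complex \<Rightarrow> 'w \<Rightarrow> 'w) \<Rightarrow> nat \<Rightarrow> ('w::ring) U_elem \<Rightarrow> 'w U_elem" where
  "U_incl scale N b = (\<Union>p\<in>b. U_ideal scale N +>\<^bsub>free_alg (gl N)\<^esub> p)"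

text \<open>
  The extension to \<open>U\<close>, by derivations, of the action of a complex \<open>N \<times> N\<close> matrix.
\<close>

definition U_act ::
  "(complex \<Rightarrow> 'w \<Rightarrow> 'w) \<Rightarrow> nat \<Rightarrow> complex mat \<Rightarrow> ('w::ring) U_elem \<Rightarrow> 'w U_elem" where
  "U_act scale N X =
    (THE D. algebra_derivation (U scale N) D \<and>
      (\<forall>A\<in>gl N. D (U_of scale N A) = U_of scale N (gl_act scale N X A)))"


section \<open>Invariants, projections and the projective limit\<close>

definition gl_sub :: "nat \<Rightarrow> nat \<Rightarrow> complex mat set" where
  "gl_sub d N = {X. \<forall>i j. i \<notin> {d+1..N} \<or> j \<notin> {d+1..N} \<longrightarrow> X i j = 0}"

definition A_level ::
  "(complex \<Rightarrow> 'w \<Rightarrow> 'w) \<Rightarrow> nat \<Rightarrow> nat \<Rightarrow> ('w::ring) U_elem set" where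
  "A_level scale d N =
    {a \<in> carrier (U scale N). \<forall>X\<in>gl_sub d N. U_act scale N X a = \<zero>\<^bsub>U scale N\<^esub>}"

definition I_plus :: "(complex \<Rightarrow> 'w \<Rightarrow> 'w) \<Rightarrow> nat \<Rightarrow> ('w::ring) U_elem set" where
  "I_plus scale N = left_ideal_gen (U scale N) {E scale N i N x | i x. i \<in> {1..N}}"

definition I_minus :: "(complex \<Rightarrow> 'w \<Rightarrow> 'w) \<Rightarrow> nat \<Rightarrow> ('w::ring) U_elem set" where
  "I_minus scale N = right_ideal_gen (U scale N) {E scale N N j x | j x. j \<in> {1..N}}"

definition U_inv_NN :: "(complex \<Rightarrow> 'w \<Rightarrow> 'w) \<Rightarrow> nat \<Rightarrow> ('w::ring) U_elem set" where
  "U_inv_NN scale N =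
    {a \<in> carrier (U scale N). U_act scale N (mat_unit N N 1) a = \<zero>\<^bsub>U scale N\<^esub>}"

text \<open>
  The intersections of \<open>I_plus\<close> and of \<open>I_minus\<close> with \<open>U_inv_NN\<close> coincide.
\<close>

definition L_ideal :: "(complex \<Rightarrow> 'w \<Rightarrow> 'w) \<Rightarrow> nat \<Rightarrow> ('w::ring) U_elem set" where
  "L_ideal scale N = I_plus scale N \<inter> I_minus scale N \<inter> U_inv_NN scale N"

text \<open>
  \<open>U_proj scale N\<close> maps level \<open>N\<close> to level \<open>N - 1\<close>: the projection of \<open>U_inv_NN\<close>
  onto level \<open>N - 1\<close> along \<open>L_ideal\<close>.
\<close>

definition U_proj ::
  "(complex \<Rightarrow> 'w \<Rightarrow> 'w) \<Rightarrow> nat \<Rightarrow> ('w::ring) U_elem \<Rightarrow> 'w U_elem" where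
  "U_proj scale N a =
    (THE b. b \<in> carrier (U scale (N - 1)) \<and>
      (\<exists>l\<in>L_ideal scale N. a = U_incl scale N b \<oplus>\<^bsub>U scale N\<^esub> l))"

definition A_lim ::
  "(complex \<Rightarrow> 'w \<Rightarrow> 'w) \<Rightarrow> nat \<Rightarrow> (complex, nat \<Rightarrow> ('w::ring) U_elem) module" where
  "A_lim scale d =
    \<lparr>carrier = {a \<in> extensional {d..}.
        (\<forall>N\<ge>d. a N \<in> A_level scale d N) \<and>
        (\<forall>N>d. U_proj scale N (a N) = a (N - 1)) \<and>
        (\<exists>n. \<forall>N\<ge>d. a N \<in> U_filtration scale N n)},
     mult = (\<lambda>a b. \<lambda>N\<in>{d..}. a N \<otimes>\<^bsub>U scale N\<^esub> b N),
     one = (\<lambda>N\<in>{d..}. \<one>\<^bsub>U scale N\<^esub>),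
     zero = (\<lambda>N\<in>{d..}. \<zero>\<^bsub>U scale N\<^esub>),
     add = (\<lambda>a b. \<lambda>N\<in>{d..}. a N \<oplus>\<^bsub>U scale N\<^esub> b N),
     smult = (\<lambda>c a. \<lambda>N\<in>{d..}. c \<odot>\<^bsub>U scale N\<^esub> a N)\<rparr>"


section \<open>The Yangian-type subalgebra\<close>

definition tuples :: "'w list set" where
  "tuples = {xs. xs \<noteq> []}"

definition compositions :: "nat \<Rightarrow> nat list set" where
  "compositions m = {\<nu>. 0 \<notin> set \<nu> \<and> sum_list \<nu> = m}"

text \<open>Product of a non-empty list; the value at the empty list is irrelevant.\<close>

fun ne_prod :: "('w::ring) list \<Rightarrow> 'w" where
  "ne_prod [] = 0"
| "ne_prod (x # xs) = foldl (*) x xs"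

text \<open>The operation \<open>\<rhd>\<close>: multiply out consecutive blocks of lengths \<open>\<nu>\<close>.\<close>

fun coarsen :: "('w::ring) list \<Rightarrow> nat list \<Rightarrow> 'w list" where
  "coarsen xs [] = []"
| "coarsen xs (n # \<nu>) = ne_prod (take n xs) # coarsen (drop n xs) \<nu>"

text \<open>
  In \<open>e_gen\<close>, \<open>as\<close> is the tuple of the summation indices, so that \<open>i # as @ [j]\<close> lists all the
  matrix indices along the monomial.
\<close>

definition e_gen ::
  "(complex \<Rightarrow> 'w \<Rightarrow> 'w) \<Rightarrow> nat \<Rightarrow> nat \<Rightarrow> nat \<Rightarrow> 'w list \<Rightarrow> ('w::ring) U_elem" where
  "e_gen scale N i j xs =
    (\<Oplus>\<^bsub>U scale N\<^esub> as \<in> {as. length as = length xs - 1 \<and> set as \<subseteq> {1..N}}.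
      list_prod (U scale N)
        (map (\<lambda>k. E scale N ((i # as @ [j]) ! k) ((i # as @ [j]) ! Suc k) (xs ! k))
          [0..<length xs]))"

definition t_level ::
  "(complex \<Rightarrow> 'w \<Rightarrow> 'w) \<Rightarrow> nat \<Rightarrow> complex \<Rightarrow> nat \<Rightarrow> nat \<Rightarrow> 'w list \<Rightarrow> ('w::ring) U_elem" where
  "t_level scale N s i j xs =
    (\<Oplus>\<^bsub>U scale N\<^esub> \<nu> \<in> compositions (length xs).
      (- of_nat N - s) ^ (length xs - length (coarsen xs \<nu>))
        \<odot>\<^bsub>U scale N\<^esub> e_gen scale N i j (coarsen xs \<nu>))"

definition t_gen ::
  "(complex \<Rightarrow> 'w \<Rightarrow> 'w) \<Rightarrow> nat \<Rightarrow> complex \<Rightarrow> nat \<Rightarrow> nat \<Rightarrow> 'w list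
    \<Rightarrow> (nat \<Rightarrow> ('w::ring) U_elem)" where
  "t_gen scale d s i j xs = (\<lambda>N\<in>{d..}. t_level scale N s i j xs)"

definition Y :: "(complex \<Rightarrow> 'w \<Rightarrow> 'w) \<Rightarrow> nat \<Rightarrow> complex
    \<Rightarrow> (complex, nat \<Rightarrow> ('w::ring) U_elem) module" where
  "Y scale d s =
    (A_lim scale d)\<lparr>carrier :=
      generate_algebra (A_lim scale d)
        {t_gen scale d s i j xs | i j xs. i \<in> {1..d} \<and> j \<in> {1..d} \<and> xs \<in> tuples}\<rparr>"

definition complex_add_group :: "complex monoid" where
  "complex_add_group = \<lparr>carrier = UNIV, mult = (+), one = 0\<rparr>"

end

theory Submission
  imports Defs
begin

text \<open>
  The key is a second projection from level \<open>N + 1\<close> to level \<open>N\<close>, opposite to the one that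
  defines the projective limit.  Let \<open>k\<close> be the span of the \<open>E\<^bsub>N+1,j\<^esub>(x)\<close>, \<open>1 \<le> j \<le> N + 1\<close>.
  There is a linear map \<open>\<Phi>\<close> from \<open>U(gl(N+1,\<Omega>))\<close> to \<open>U(gl(N,\<Omega>))\<close> with \<open>\<Phi>(1) = 1\<close>,
  \<open>\<Phi>(u x) = \<Phi>(u) x\<close> for \<open>x\<close> in \<open>gl(N,\<Omega>)\<close> and \<open>\<Phi>(u x) = 0\<close> for \<open>x\<close> in \<open>k\<close>.  Pushing the
  entries of the last row to the right in the monomials of \<open>e\<^bsub>ij\<^esub>(x;N+1)\<close> gives
  \<open>\<Phi>(u e\<^bsub>ij\<^esub>(x;N+1)) = \<Phi>(u) e\<^bsub>ij\<^esub>(x;N)\<close> for \<open>i, j \<le> N\<close>.  The coefficients of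
  \<open>t\<^bsub>ij\<^esub>(x;N+1;s)\<close> depend on \<open>N + 1 + s = N + (s + 1)\<close> only, hence
  \<open>\<Phi>(u t\<^bsub>ij\<^esub>(x;N+1;s)) = \<Phi>(u) t\<^bsub>ij\<^esub>(x;N;s+1)\<close> (\<open>Phi_mult_shift_family\<close>).

  It follows that a polynomial relation satisfied by the elements \<open>t\<^bsub>ij\<^esub>(x;s)\<close> is also satisfied by
  the elements \<open>t\<^bsub>ij\<^esub>(x;s+n)\<close>, for every natural number \<open>n\<close>.  At each level the left-hand side of the
  relation for \<open>t\<^bsub>ij\<^esub>(x;s+c)\<close> is a polynomial in \<open>c\<close> with coefficients in the enveloping algebra.  As it
  vanishes at all natural numbers, it vanishes for all complex \<open>c\<close> (\<open>shift_family_vanish\<close>), and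
  \<open>Shift\<^sub>c\<close> is well defined.  It maps \<open>Y\<^sub>d(\<Omega>)\<close> to itself because \<open>t\<^bsub>ij\<^esub>(x;s+c)\<close> is a linear combination
  of elements \<open>t\<^bsub>ij\<^esub>(y;s)\<close>, where \<open>y\<close> runs over the coarsenings of \<open>x\<close> (\<open>merge_sum_merge_sum\<close>).

  The map \<open>\<Phi>\<close> is constructed without the Poincare-Birkhoff-Witt theorem.  It is defined on words of the
  free algebra by recursion on the length: the \<open>gl(N)\<close>-component \<open>A\<^sub>0\<close> of the first letter \<open>A\<close> is pulled
  out to the left, its component in the last column is dropped, and its component \<open>A'\<close> in \<open>k\<close> is
  commuted through the rest of the word, which leaves a sum over the remaining letters \<open>B\<close> of words
  where \<open>B\<close> is replaced by \<open>[A', B]\<close>.  The Jacobi identity and induction on the length show that this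
  respects the relations of the enveloping algebra (\<open>phi_multilinear\<close>, \<open>phi_bracket\<close>).

  All calculations are carried out with representatives in the free algebras, modulo the defining
  ideals.
\<close>

section \<open>Free algebras and linear maps on them\<close>

type_synonym 'g fa = "'g word \<Rightarrow>\<^sub>0 complex"

text \<open>The scalar \<open>c\<close> as an element of the free algebra.\<close>

abbreviation scal :: "complex \<Rightarrow> 'g fa" where
  "scal c \<equiv> Poly_Mapping.single 0 c"

abbreviation word_mon :: "'g list \<Rightarrow> 'g fa" where
  "word_mon xs \<equiv> Poly_Mapping.single (Word xs) 1"

lemma word_mon_Nil: "word_mon [] = 1"
  by (simp flip: zero_word_def)

lemma word_mon_append: "word_mon (xs @ ys) = word_mon xs * word_mon ys"
  by (simp add: mult_single plus_word_def)

lemma word_mon_single: "word_mon [x] = letter x"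
  by (simp add: letter_def)

lemma word_mon_Cons: "word_mon (x # xs) = letter x * word_mon xs"
  using word_mon_append[of "[x]" xs] by (simp add: letter_def)

lemma single_eq_scal_word_mon: "Poly_Mapping.single w c = scal c * word_mon (letters w)"
  by (cases w) (simp add: mult_single)

lemma scal_mult: "scal (a * b) = scal a * scal b"
  by (simp add: mult_single)

lemma poly_mapping_eq_sum_single:
  "p = (\<Sum>w\<in>Poly_Mapping.keys p. Poly_Mapping.single w (Poly_Mapping.lookup p w))"
  by (rule poly_mapping_eqI)
    (auto simp: lookup_sum lookup_single when_def in_keys_iff)

lemma poly_mapping_single_induct [case_names single add]:
  fixes p :: "'a \<Rightarrow>\<^sub>0 'b::comm_monoid_add"
  assumes single: "\<And>w c. P (Poly_Mapping.single w c)"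
    and add: "\<And>p q. P p \<Longrightarrow> P q \<Longrightarrow> P (p + q)"
  shows "P p"
proof -
  have "P (\<Sum>w\<in>A. Poly_Mapping.single w (Poly_Mapping.lookup p w))" if "finite A" for A
    using that
  proof induction
    case empty
    show ?case using single[of _ 0] by simp
  qed (simp add: single add)
  from this[OF finite_keys, of p] show ?thesis
    by (simp flip: poly_mapping_eq_sum_single)
qed

lemma scal_commute: "scal c * p = p * scal c"
proof (induction p rule: poly_mapping_single_induct)
  case (single w a)
  show ?case by (simp add: mult_single mult.commute)
qed (simp add: distrib_left distrib_right)

lemma scal_left_commute: "p * (scal c * q) = scal c * (p * q)"
  by (metis mult.assoc scal_commute)

text \<open>The linear extension to the free algebra of a function on words.\<close>

definition linear_ext :: "('g list \<Rightarrow> 'h fa) \<Rightarrow> 'g fa \<Rightarrow> 'h fa" where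
  "linear_ext f p = (\<Sum>w\<in>Poly_Mapping.keys p. scal (Poly_Mapping.lookup p w) * f (letters w))"

lemma linear_ext_superset:
  assumes "finite S" "Poly_Mapping.keys p \<subseteq> S"
  shows "linear_ext f p = (\<Sum>w\<in>S. scal (Poly_Mapping.lookup p w) * f (letters w))"
  unfolding linear_ext_def using assms
  by (intro sum.mono_neutral_left) (auto simp: in_keys_iff)

lemma linear_ext_add: "linear_ext f (p + q) = linear_ext f p + linear_ext f q"
proof -
  let ?S = "Poly_Mapping.keys p \<union> Poly_Mapping.keys q"
  show ?thesis
    using linear_ext_superset[of ?S p f] linear_ext_superset[of ?S q f]
      linear_ext_superset[of ?S "p + q" f] keys_add[of p q]
    by (simp add: lookup_add single_add distrib_right sum.distrib)
qed

lemma linear_ext_single: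
  "linear_ext f (Poly_Mapping.single w c) = scal c * f (letters w)"
  by (subst linear_ext_superset[of "{w}"]) auto

lemma linear_ext_scal: "linear_ext f (scal c * p) = scal c * linear_ext f p"
proof (induction p rule: poly_mapping_single_induct)
  case (single w a)
  show ?case by (simp add: mult_single linear_ext_single flip: mult.assoc)
qed (simp add: distrib_left linear_ext_add)

lemma linear_ext_word_mon: "linear_ext f (word_mon xs) = f xs"
  by (simp add: linear_ext_single)

lemma linear_ext_zero: "linear_ext f 0 = 0"
  by (simp add: linear_ext_def)

lemma linear_ext_uminus: "linear_ext f (- p) = - linear_ext f p"
  using linear_ext_add[of f p "- p"] by (simp add: linear_ext_zero eq_neg_iff_add_eq_0 add.commute)

lemma linear_ext_diff: "linear_ext f (p - q) = linear_ext f p - linear_ext f q"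
  using linear_ext_add[of f p "- q"] by (simp add: linear_ext_uminus)

lemma linear_ext_sum: "linear_ext f (sum g A) = (\<Sum>a\<in>A. linear_ext f (g a))"
  by (induction A rule: infinite_finite_induct) (simp_all add: linear_ext_zero linear_ext_add)
text \<open>
  \<open>slot_sum f \<delta> xs\<close> is the sum, over the positions of the word \<open>xs\<close>, of the values of \<open>f\<close> at the word
  where \<open>\<delta>\<close> has been applied to the letter in this position.  For \<open>f\<close> multilinear and \<open>\<delta>\<close> linear,
  it is the value of the linear extension of \<open>f\<close> at the image of \<open>xs\<close> under the derivation of the
  tensor algebra that extends \<open>\<delta>\<close>.
\<close>

fun slot_sum :: "('a list \<Rightarrow> 'b::comm_monoid_add) \<Rightarrow> ('a \<Rightarrow> 'a) \<Rightarrow> 'a list \<Rightarrow> 'b" where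
  "slot_sum f \<delta> [] = 0"
| "slot_sum f \<delta> (x # xs) = f (\<delta> x # xs) + slot_sum (\<lambda>ys. f (x # ys)) \<delta> xs"

text \<open>As a congruence rule this yields termination of the recursion through \<open>slot_sum\<close> below.\<close>

lemma slot_sum_cong [fundef_cong]:
  assumes "xs = xs'" "\<delta> = \<delta>'" "\<And>ys. length ys = length xs' \<Longrightarrow> f ys = g ys"
  shows "slot_sum f \<delta> xs = slot_sum g \<delta>' xs'"
proof -
  have "(\<And>ys. length ys = length xs' \<Longrightarrow> f ys = g ys) \<Longrightarrow> slot_sum f \<delta>' xs' = slot_sum g \<delta>' xs'"
  proof (induction xs' arbitrary: f g)
    case (Cons x xs')
    have "slot_sum (\<lambda>ys. f (x # ys)) \<delta>' xs' = slot_sum (\<lambda>ys. g (x # ys)) \<delta>' xs'"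
      using Cons.prems by (intro Cons.IH) simp
    then show ?case using Cons.prems by simp
  qed simp
  with assms show ?thesis by simp
qed

lemma slot_sum_append:
  "slot_sum f \<delta> (xs @ ys) =
    slot_sum (\<lambda>zs. f (zs @ ys)) \<delta> xs + slot_sum (\<lambda>zs. f (xs @ zs)) \<delta> ys"
  by (induction xs arbitrary: f) (simp_all add: add.assoc)

lemma slot_sum_add: "slot_sum (\<lambda>v. f v + g v) \<delta> xs = slot_sum f \<delta> xs + slot_sum g \<delta> xs"
  by (induction xs arbitrary: f g) (simp_all add: ac_simps)

lemma slot_sum_diff:
  fixes f :: "'a list \<Rightarrow> 'b::ab_group_add"
  shows "slot_sum (\<lambda>v. f v - g v) \<delta> xs = slot_sum f \<delta> xs - slot_sum g \<delta> xs"
  by (induction xs arbitrary: f g) (simp_all add: algebra_simps)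

lemma slot_sum_mult_left:
  fixes f :: "'a list \<Rightarrow> 'b::semiring_0"
  shows "slot_sum (\<lambda>v. a * f v) \<delta> xs = a * slot_sum f \<delta> xs"
  by (induction xs arbitrary: f) (simp_all add: algebra_simps)

lemma slot_sum_mult_right:
  fixes f :: "'a list \<Rightarrow> 'b::semiring_0"
  shows "slot_sum (\<lambda>v. f v * a) \<delta> xs = slot_sum f \<delta> xs * a"
  by (induction xs arbitrary: f) (simp_all add: algebra_simps)

text \<open>
  The projection on words: \<open>tr\<close> is the component of a letter that is pulled out to the left, and
  \<open>ad x\<close> is the bracket with the component of \<open>x\<close> that is moved to the right.
\<close>

function tri_word :: "('g \<Rightarrow> 'h) \<Rightarrow> ('g \<Rightarrow> 'g \<Rightarrow> 'g) \<Rightarrow> 'g list \<Rightarrow> 'h fa" where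
  "tri_word tr ad [] = 1"
| "tri_word tr ad (x # xs) =
    letter (tr x) * tri_word tr ad xs + slot_sum (tri_word tr ad) (ad x) xs"
  by pat_completeness auto
termination by (relation "measure (\<lambda>(tr, ad, xs). length xs)") auto

section \<open>Congruences modulo an ideal\<close>

text \<open>
  A subset \<open>I\<close> closed under addition and under multiplication, from both sides, by the elements of
  a subalgebra \<open>C\<close>.  It need not be contained in \<open>C\<close>.
\<close>

locale subalgebra_ideal =
  fixes C I :: "'g fa set"
  assumes scal_C: "scal c \<in> C"
    and add_C: "p \<in> C \<Longrightarrow> q \<in> C \<Longrightarrow> p + q \<in> C"
    and mult_C: "p \<in> C \<Longrightarrow> q \<in> C \<Longrightarrow> p * q \<in> C"
    and zero_I: "0 \<in> I"
    and add_I: "p \<in> I \<Longrightarrow> q \<in> I \<Longrightarrow> p + q \<in> I"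
    and left_I: "p \<in> C \<Longrightarrow> q \<in> I \<Longrightarrow> p * q \<in> I"
    and right_I: "p \<in> C \<Longrightarrow> q \<in> I \<Longrightarrow> q * p \<in> I"
begin

lemma scal_I: "p \<in> I \<Longrightarrow> scal c * p \<in> I"
  by (rule left_I[OF scal_C])

lemma uminus_I: "p \<in> I \<Longrightarrow> - p \<in> I"
  using scal_I[of p "-1"] by (simp add: single_uminus)

lemma diff_I: "p \<in> I \<Longrightarrow> q \<in> I \<Longrightarrow> p - q \<in> I"
  using add_I[of p "- q"] uminus_I by simp

lemma zero_C: "0 \<in> C"
  using scal_C[of 0] by simp

lemma one_C: "1 \<in> C"
  using scal_C[of 1] by simp

lemma sum_I: "(\<And>x. x \<in> A \<Longrightarrow> f x \<in> I) \<Longrightarrow> sum f A \<in> I"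
  by (induction A rule: infinite_finite_induct) (auto simp: zero_I add_I)

lemma sum_C: "(\<And>x. x \<in> A \<Longrightarrow> f x \<in> C) \<Longrightarrow> sum f A \<in> C"
  by (induction A rule: infinite_finite_induct) (auto simp: zero_C add_C)

definition cong :: "'g fa \<Rightarrow> 'g fa \<Rightarrow> bool" (infix "\<doteq>" 50) where
  "p \<doteq> q \<longleftrightarrow> p - q \<in> I"

lemma cong_refl [simp]: "p \<doteq> p"
  by (simp add: cong_def zero_I)

lemma cong_sym: "p \<doteq> q \<Longrightarrow> q \<doteq> p"
  unfolding cong_def using uminus_I[of "p - q"] by simp

lemma cong_trans [trans]: "p \<doteq> q \<Longrightarrow> q \<doteq> r \<Longrightarrow> p \<doteq> r"
  unfolding cong_def using add_I[of "p - q" "q - r"] by simp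

lemma cong_eq_trans [trans]: "p \<doteq> q \<Longrightarrow> q = r \<Longrightarrow> p \<doteq> r"
  by simp

lemma eq_cong_trans [trans]: "p = q \<Longrightarrow> q \<doteq> r \<Longrightarrow> p \<doteq> r"
  by simp

lemma cong_add: "p \<doteq> q \<Longrightarrow> p' \<doteq> q' \<Longrightarrow> p + p' \<doteq> q + q'"
  unfolding cong_def using add_I[of "p - q" "p' - q'"] by (simp add: algebra_simps)

lemma cong_diff: "p \<doteq> q \<Longrightarrow> p' \<doteq> q' \<Longrightarrow> p - p' \<doteq> q - q'"
  unfolding cong_def using diff_I[of "p - q" "p' - q'"] by (simp add: algebra_simps)

lemma cong_left: "a \<in> C \<Longrightarrow> p \<doteq> q \<Longrightarrow> a * p \<doteq> a * q"
  unfolding cong_def using left_I[of a "p - q"] by (simp add: algebra_simps)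

lemma cong_right: "a \<in> C \<Longrightarrow> p \<doteq> q \<Longrightarrow> p * a \<doteq> q * a"
  unfolding cong_def using right_I[of a "p - q"] by (simp add: algebra_simps)

lemma cong_scal: "p \<doteq> q \<Longrightarrow> scal c * p \<doteq> scal c * q"
  by (rule cong_left[OF scal_C])

lemma cong_sum: "(\<And>x. x \<in> A \<Longrightarrow> f x \<doteq> g x) \<Longrightarrow> sum f A \<doteq> sum g A"
  by (induction A rule: infinite_finite_induct) (auto intro: cong_add)

lemma cong_0_iff: "p \<doteq> 0 \<longleftrightarrow> p \<in> I"
  by (simp add: cong_def)

lemma slot_sum_C: "(\<And>ys. length ys = length xs \<Longrightarrow> f ys \<in> C) \<Longrightarrow> slot_sum f \<delta> xs \<in> C"
  by (induction xs arbitrary: f) (auto simp: zero_C intro: add_C)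

lemma slot_sum_mod:
  "(\<And>ys. length ys = length xs \<Longrightarrow> f ys \<doteq> g ys) \<Longrightarrow> slot_sum f \<delta> xs \<doteq> slot_sum g \<delta> xs"
  by (induction xs arbitrary: f g) (auto intro: cong_add)

end

section \<open>The projection of a Lie algebra with a triangular decomposition\<close>

text \<open>
  A Lie algebra, given by its bracket \<open>br\<close>, is the sum of a subalgebra \<open>G0\<close>, of a subalgebra \<open>n\<close> and of a
  subalgebra \<open>k\<close>, with \<open>[G0, n]\<close> contained in \<open>n\<close> and \<open>[k, G0]\<close> contained in \<open>k\<close>; the maps
  \<open>tr\<close> and \<open>kp\<close> are the projections to \<open>G0\<close> and \<open>k\<close>.  The assumptions \<open>split_kp\<close> and \<open>split_tr\<close> say this
  of the element \<open>[x, y] - [x', y] + [y', x] - [y', x']\<close>, where the prime denotes the component in \<open>k\<close>: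
  it equals \<open>[x - x', y - y']\<close>, so its component in \<open>k\<close> is zero and its component in \<open>G0\<close> is the bracket
  of the components of \<open>x\<close> and \<open>y\<close>.  The ideal \<open>I\<close> of the algebra \<open>C\<close> contains the relations of the
  universal enveloping algebra of \<open>G0\<close>.
\<close>

locale triangular_projection = subalgebra_ideal C I
  for C I :: "'g::ab_group_add fa set" +
  fixes G0 :: "'g set"
    and sc :: "complex \<Rightarrow> 'g \<Rightarrow> 'g"
    and br br0 :: "'g \<Rightarrow> 'g \<Rightarrow> 'g"
    and tr kp :: "'g \<Rightarrow> 'g"
  assumes letter_C: "x \<in> G0 \<Longrightarrow> letter x \<in> C"
    and linear_I: "x \<in> G0 \<Longrightarrow> y \<in> G0 \<Longrightarrow> letter (x + sc c y) \<doteq> letter x + scal c * letter y"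
    and bracket_I: "x \<in> G0 \<Longrightarrow> y \<in> G0 \<Longrightarrow>
      letter x * letter y - letter y * letter x \<doteq> letter (br0 x y)"
    and sc_one: "sc 1 x = x"
    and br_left: "br (x + sc c y) z = br x z + sc c (br y z)"
    and br_right: "br z (x + sc c y) = br z x + sc c (br z y)"
    and jacobi: "br x (br y z) = br (br x y) z + br y (br x z)"
    and tr_G0: "tr x \<in> G0"
    and tr_linear: "tr (x + sc c y) = tr x + sc c (tr y)"
    and kp_linear: "kp (x + sc c y) = kp x + sc c (kp y)"
    and tr_kp: "tr (kp x) = 0"
    and kp_br_kp: "kp (br (kp x) (kp y)) = br (kp x) (kp y)"
    and split_kp: "kp (br x y - br (kp x) y + br (kp y) x - br (kp y) (kp x)) = 0"
    and split_tr: "tr (br x y - br (kp x) y + br (kp y) x - br (kp y) (kp x)) = br0 (tr x) (tr y)"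
    and tr_on_G0: "x \<in> G0 \<Longrightarrow> tr x = x"
    and kp_br_G0: "x \<in> G0 \<Longrightarrow> kp (br (kp a) x) = br (kp a) x"
begin

abbreviation ad where "ad x \<equiv> br (kp x)"

abbreviation \<phi> :: "'g list \<Rightarrow> 'g fa" where
  "\<phi> \<equiv> tri_word tr ad"

lemma br_zero_left: "br 0 z = 0"
  using br_left[of 0 1 0 z] by (simp add: sc_one)

lemma letter_0: "letter 0 \<doteq> 0"
proof -
  have "0 \<in> G0" using tr_G0[of "kp 0"] by (simp add: tr_kp)
  from linear_I[OF this this, of 1] show ?thesis
    by (simp add: sc_one cong_def) (metis uminus_I minus_minus)
qed

lemma phi_C: "\<phi> xs \<in> C"
proof (induction xs rule: length_induct)
  case (1 xs)
  show ?case
  proof (cases xs)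
    case (Cons x ys)
    then show ?thesis
      using 1 unfolding Cons tri_word.simps
      by (intro add_C mult_C letter_C tr_G0 slot_sum_C) simp_all
  qed (simp add: one_C)
qed

text \<open>Linearity, modulo the ideal, in each letter on words of length \<open>n\<close>.\<close>

definition multilinear_at :: "nat \<Rightarrow> ('g list \<Rightarrow> 'g fa) \<Rightarrow> bool" where
  "multilinear_at n f \<longleftrightarrow> (\<forall>u v x y c. Suc (length u + length v) = n \<longrightarrow>
    f (u @ (x + sc c y) # v) \<doteq> f (u @ x # v) + scal c * f (u @ y # v))"

lemma multilinear_at_Cons:
  "multilinear_at (Suc n) f \<Longrightarrow> multilinear_at n (\<lambda>v. f (x # v))"
  unfolding multilinear_at_def by (metis append_Cons length_Cons add_Suc)

lemma multilinear_at_head: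
  "multilinear_at (Suc (length v)) f \<Longrightarrow>
    f ((x + sc c y) # v) \<doteq> f (x # v) + scal c * f (y # v)"
  unfolding multilinear_at_def by (metis append_Nil list.size(3) add_0)

lemma slot_sum_linear:
  assumes "multilinear_at (length xs) f"
  shows "slot_sum f (\<lambda>t. \<delta> t + sc c (\<epsilon> t)) xs \<doteq> slot_sum f \<delta> xs + scal c * slot_sum f \<epsilon> xs"
  using assms
proof (induction xs arbitrary: f)
  case (Cons a xs)
  have "slot_sum f (\<lambda>t. \<delta> t + sc c (\<epsilon> t)) (a # xs) \<doteq>
    (f (\<delta> a # xs) + scal c * f (\<epsilon> a # xs)) +
    (slot_sum (\<lambda>ys. f (a # ys)) \<delta> xs + scal c * slot_sum (\<lambda>ys. f (a # ys)) \<epsilon> xs)"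
    using Cons.prems unfolding slot_sum.simps list.size(4)
    by (intro cong_add multilinear_at_head Cons.IH multilinear_at_Cons) simp_all
  then show ?case by (simp add: algebra_simps)
qed simp

lemma phi_multilinear: "multilinear_at n \<phi>"
proof (induction n rule: less_induct)
  case (less n)
  have "\<phi> (u @ (x + sc c y) # v) \<doteq> \<phi> (u @ x # v) + scal c * \<phi> (u @ y # v)"
    if n: "Suc (length u + length v) = n" for u v x y c
  proof (cases u)
    case Nil
    have ad: "ad (x + sc c y) = (\<lambda>t. ad x t + sc c (ad y t))"
      by (simp add: fun_eq_iff kp_linear br_left)
    have "\<phi> ((x + sc c y) # v) \<doteq> (letter (tr x) + scal c * letter (tr y)) * \<phi> v +
        (slot_sum \<phi> (ad x) v + scal c * slot_sum \<phi> (ad y) v)"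
      unfolding tri_word.simps ad tr_linear using n
      by (intro cong_add cong_right phi_C linear_I tr_G0 slot_sum_linear less.IH) simp
    also have "\<dots> = \<phi> (x # v) + scal c * \<phi> (y # v)"
      by (simp add: algebra_simps)
    finally show ?thesis by (simp add: Nil)
  next
    case (Cons a u')
    have m: "\<phi> (u @ (x + sc c y) # v) \<doteq> \<phi> (u @ x # v) + scal c * \<phi> (u @ y # v)"
      if "Suc (length u + length v) < n" for u x y v
      using less.IH[OF that] unfolding multilinear_at_def by blast
    have "\<phi> (u @ (x + sc c y) # v) \<doteq>
      letter (tr a) * (\<phi> (u' @ x # v) + scal c * \<phi> (u' @ y # v)) +
      (slot_sum (\<lambda>zs. \<phi> (zs @ x # v) + scal c * \<phi> (zs @ y # v)) (ad a) u' +
        ((\<phi> (u' @ ad a x # v) + scal c * \<phi> (u' @ ad a y # v)) +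
         slot_sum (\<lambda>zs. \<phi> (u' @ x # zs) + scal c * \<phi> (u' @ y # zs)) (ad a) v))"
      unfolding Cons append_Cons tri_word.simps slot_sum_append slot_sum.simps br_right using n Cons
      by (intro cong_add cong_left letter_C tr_G0 m slot_sum_mod) simp_all
    also have "\<dots> = \<phi> (u @ x # v) + scal c * \<phi> (u @ y # v)"
      unfolding Cons append_Cons tri_word.simps slot_sum_append slot_sum.simps slot_sum_add
        slot_sum_mult_left distrib_left scal_left_commute
      by (simp only: ac_simps)
    finally show ?thesis .
  qed
  then show ?case by (auto simp: multilinear_at_def)
qed

lemma phi_linear: "\<phi> (u @ (x + sc c y) # v) \<doteq> \<phi> (u @ x # v) + scal c * \<phi> (u @ y # v)"
  using phi_multilinear by (auto simp: multilinear_at_def)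

lemma phi_add: "\<phi> (u @ (x + y) # v) \<doteq> \<phi> (u @ x # v) + \<phi> (u @ y # v)"
  using phi_linear[of u x 1 y v] by (simp add: sc_one)

lemma phi_zero: "\<phi> (u @ 0 # v) \<doteq> 0"
  using phi_add[of u 0 0 v] by (simp add: cong_def) (metis uminus_I minus_minus)

lemma phi_diff: "\<phi> (u @ (x - y) # v) \<doteq> \<phi> (u @ x # v) - \<phi> (u @ y # v)"
  using phi_add[of u "x - y" y v] cong_sym by (auto simp: cong_def algebra_simps)

text \<open>
  The commutator of two derivations is the derivation that extends the commutator.  The
  terms that change two different letters cancel.
\<close>

lemma slot_sum_commutator:
  assumes m: "\<And>u v x y. Suc (length u + length v) = length xs \<Longrightarrow>
      f (u @ (x - y) # v) \<doteq> f (u @ x # v) - f (u @ y # v)"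
  shows "slot_sum (slot_sum f \<delta>) \<epsilon> xs - slot_sum (slot_sum f \<epsilon>) \<delta> xs
    \<doteq> slot_sum f (\<lambda>t. \<delta> (\<epsilon> t) - \<epsilon> (\<delta> t)) xs"
  using m
proof (induction xs arbitrary: f)
  case (Cons a xs)
  let ?g = "\<lambda>v. f (a # v)"
  have "slot_sum (slot_sum f \<delta>) \<epsilon> (a # xs) - slot_sum (slot_sum f \<epsilon>) \<delta> (a # xs) =
    (f (\<delta> (\<epsilon> a) # xs) - f (\<epsilon> (\<delta> a) # xs)) +
    (slot_sum (slot_sum ?g \<delta>) \<epsilon> xs - slot_sum (slot_sum ?g \<epsilon>) \<delta> xs)"
    by (simp add: slot_sum_add algebra_simps)
  also have "\<dots> \<doteq> f ((\<delta> (\<epsilon> a) - \<epsilon> (\<delta> a)) # xs) + slot_sum ?g (\<lambda>t. \<delta> (\<epsilon> t) - \<epsilon> (\<delta> t)) xs"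
  proof (rule cong_add)
    show "f (\<delta> (\<epsilon> a) # xs) - f (\<epsilon> (\<delta> a) # xs) \<doteq> f ((\<delta> (\<epsilon> a) - \<epsilon> (\<delta> a)) # xs)"
      by (rule cong_sym) (use Cons.prems[of "[]" xs] in simp)
    show "slot_sum (slot_sum ?g \<delta>) \<epsilon> xs - slot_sum (slot_sum ?g \<epsilon>) \<delta> xs
      \<doteq> slot_sum ?g (\<lambda>t. \<delta> (\<epsilon> t) - \<epsilon> (\<delta> t)) xs"
      using Cons.prems[of "a # _"] by (intro Cons.IH) simp
  qed
  finally show ?case by simp
qed simp

lemma ad_bracket: "br x (br y t) - br y (br x t) = br (br x y) t"
  by (simp add: jacobi[of x y t])

text \<open>
  The relation \<open>x y - y x = [x, y]\<close> at the beginning of a word, where it is a consequence of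
  the relation for the components in \<open>G0\<close> and of \<open>slot_sum_commutator\<close>.
\<close>

lemma phi_bracket_head:
  "\<phi> (x # y # w) - \<phi> (y # x # w) \<doteq> \<phi> (br x y # w)"
proof -
  \<comment> \<open>The part of \<open>[x, y]\<close> that does not come from moving the components in \<open>k\<close> to the right.\<close>
  define z where "z = br x y - ad x y + ad y x - ad y (kp x)"
  have expand: "\<phi> (x # y # w) = letter (tr x) * letter (tr y) * \<phi> w +
      letter (tr x) * slot_sum \<phi> (ad y) w + letter (tr y) * slot_sum \<phi> (ad x) w +
      (\<phi> (ad x y # w) + slot_sum (slot_sum \<phi> (ad y)) (ad x) w)" for x y
    unfolding tri_word.simps(2)[of _ _ x "y # w"] slot_sum.simps tri_word.simps(2)[of _ _ y]
      slot_sum_add slot_sum_mult_left distrib_left mult.assoc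
    by (simp only: ac_simps)
  have "\<phi> (x # y # w) - \<phi> (y # x # w) =
    (letter (tr x) * letter (tr y) - letter (tr y) * letter (tr x)) * \<phi> w +
    ((\<phi> (ad x y # w) - \<phi> (ad y x # w)) +
     (slot_sum (slot_sum \<phi> (ad y)) (ad x) w - slot_sum (slot_sum \<phi> (ad x)) (ad y) w))"
    unfolding expand[of x y] expand[of y x] by (simp only: left_diff_distrib) simp
  also have "\<dots> \<doteq> letter (tr z) * \<phi> w +
    ((\<phi> (ad x y # w) - \<phi> (ad y x # w)) + slot_sum \<phi> (br (ad y (kp x))) w)"
  proof (intro cong_add cong_right phi_C cong_refl)
    show "letter (tr x) * letter (tr y) - letter (tr y) * letter (tr x) \<doteq> letter (tr z)"
      by (simp add: z_def split_tr bracket_I tr_G0)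
    show "slot_sum (slot_sum \<phi> (ad y)) (ad x) w - slot_sum (slot_sum \<phi> (ad x)) (ad y) w
      \<doteq> slot_sum \<phi> (br (ad y (kp x))) w"
      using slot_sum_commutator[of w \<phi> "ad y" "ad x"] phi_diff by (simp add: ad_bracket)
  qed
  also have "\<dots> \<doteq> \<phi> (z # w) + ((\<phi> (ad x y # w) - \<phi> (ad y x # w)) + \<phi> (ad y (kp x) # w))"
  proof (intro cong_add cong_refl)
    have "slot_sum \<phi> (br (kp z)) w \<doteq> 0"
    proof -
      have "kp z = 0" by (simp add: z_def split_kp)
      then have "br (kp z) = (\<lambda>t. 0)" by (auto simp: br_zero_left)
      then show ?thesis
        \<comment> \<open>The zero derivation is the commutator of the identity with itself.\<close>
        using cong_sym[OF slot_sum_commutator[of w \<phi> id id]] phi_diff by simp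
    qed
    from cong_sym[OF cong_add[OF cong_refl this, of "letter (tr z) * \<phi> w"]]
    show "letter (tr z) * \<phi> w \<doteq> \<phi> (z # w)" by simp
    have "kp (ad y (kp x)) = ad y (kp x)" by (rule kp_br_kp)
    moreover have "letter (tr (ad y (kp x))) * \<phi> w \<doteq> 0 * \<phi> w"
      using letter_0 tr_kp[of "ad y (kp x)"]
      by (intro cong_right phi_C) (simp add: kp_br_kp)
    from cong_add[OF this cong_refl]
    have "letter (tr (ad y (kp x))) * \<phi> w + slot_sum \<phi> (br (ad y (kp x))) w
      \<doteq> slot_sum \<phi> (br (ad y (kp x))) w"
      by (metis mult_zero_left add_0)
    ultimately show "slot_sum \<phi> (br (ad y (kp x))) w \<doteq> \<phi> (ad y (kp x) # w)"
      by (intro cong_sym[of "\<phi> (ad y (kp x) # w)"]) simp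
  qed
  also have "\<dots> \<doteq> \<phi> (br x y # w)"
  proof -
    have h: "\<phi> ((a - b) # w) \<doteq> \<phi> (a # w) - \<phi> (b # w)" 
            "\<phi> ((a + b) # w) \<doteq> \<phi> (a # w) + \<phi> (b # w)" for a b
      using phi_diff[of "[]" a b w] phi_add[of "[]" a b w] by simp_all
    have "\<phi> (z # w) \<doteq> \<phi> (br x y # w) - \<phi> (ad x y # w) + \<phi> (ad y x # w) - \<phi> (ad y (kp x) # w)"
      unfolding z_def
      by (intro cong_trans[OF h(1)] cong_trans[OF h(2)] cong_add cong_diff h cong_refl)
    from cong_add[OF this cong_refl] show ?thesis
      by (rule cong_trans) (simp add: algebra_simps)
  qed
  finally show ?thesis .
qed

text \<open>
  Inside a word, the relation is inherited from shorter words, since \<open>ad a\<close> is a derivation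
  of the bracket.
\<close>

lemma phi_bracket:
  "\<phi> (u @ x # y # v) - \<phi> (u @ y # x # v) \<doteq> \<phi> (u @ br x y # v)"
proof (induction "length u + length v" arbitrary: u v x y rule: less_induct)
  case less
  show ?case
  proof (cases u)
    case Nil
    with phi_bracket_head show ?thesis by simp
  next
    case (Cons a u')
    let ?D = "ad a"
    have IH: "\<phi> (p @ x # y # q) - \<phi> (p @ y # x # q) \<doteq> \<phi> (p @ br x y # q)"
      if "length p + length q = length u' + length v" for p q x y
      using less[of p q x y] that Cons by simp
    have expand: "\<phi> (u @ x # y # v) = letter (tr a) * \<phi> (u' @ x # y # v) +
       (slot_sum (\<lambda>z. \<phi> (z @ x # y # v)) ?D u' +
        (\<phi> (u' @ ?D x # y # v) + \<phi> (u' @ x # ?D y # v) + slot_sum (\<lambda>z. \<phi> (u' @ x # y # z)) ?D v))"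
      for x y
      unfolding Cons append_Cons tri_word.simps(2)[of _ _ a] slot_sum_append slot_sum.simps
      by (simp only: add.assoc)
    have "\<phi> (u @ x # y # v) - \<phi> (u @ y # x # v) =
       letter (tr a) * (\<phi> (u' @ x # y # v) - \<phi> (u' @ y # x # v)) +
       (slot_sum (\<lambda>z. \<phi> (z @ x # y # v) - \<phi> (z @ y # x # v)) ?D u' +
        ((\<phi> (u' @ ?D x # y # v) - \<phi> (u' @ y # ?D x # v)) +
         (\<phi> (u' @ x # ?D y # v) - \<phi> (u' @ ?D y # x # v)) +
         slot_sum (\<lambda>z. \<phi> (u' @ x # y # z) - \<phi> (u' @ y # x # z)) ?D v))"
      unfolding expand slot_sum_diff right_diff_distrib by simp
    also have "\<dots> \<doteq> letter (tr a) * \<phi> (u' @ br x y # v) +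
       (slot_sum (\<lambda>z. \<phi> (z @ br x y # v)) ?D u' +
        (\<phi> (u' @ br (?D x) y # v) + \<phi> (u' @ br x (?D y) # v) +
         slot_sum (\<lambda>z. \<phi> (u' @ br x y # z)) ?D v))"
      by (intro cong_add cong_left letter_C tr_G0 slot_sum_mod IH) simp_all
    also have "\<dots> \<doteq> letter (tr a) * \<phi> (u' @ br x y # v) +
       (slot_sum (\<lambda>z. \<phi> (z @ br x y # v)) ?D u' +
        (\<phi> (u' @ ?D (br x y) # v) + slot_sum (\<lambda>z. \<phi> (u' @ br x y # z)) ?D v))"
      unfolding jacobi[of "kp a" x y]
      by (intro cong_add cong_refl cong_sym[OF phi_add])
    also have "\<dots> = \<phi> (u @ br x y # v)"
      unfolding Cons append_Cons tri_word.simps(2)[of _ _ a] slot_sum_append slot_sum.simps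
      by (simp only: add.assoc)
    finally show ?thesis .
  qed
qed

lemma phi_last_kp: "\<phi> (u @ [kp x]) \<doteq> 0"
proof (induction "length u" arbitrary: u x rule: less_induct)
  case less
  show ?case
  proof (cases u)
    case Nil
    show ?thesis using letter_0 by (simp add: Nil tr_kp)
  next
    case (Cons a u')
    have "\<phi> (u @ [kp x]) = letter (tr a) * \<phi> (u' @ [kp x]) +
      (slot_sum (\<lambda>z. \<phi> (z @ [kp x])) (ad a) u' + \<phi> (u' @ [kp (ad a (kp x))]))"
      unfolding Cons by (simp add: slot_sum_append kp_br_kp)
    also have "\<dots> \<doteq> letter (tr a) * 0 + (slot_sum (\<lambda>z. 0) (ad a) u' + 0)"
      using Cons by (intro cong_add cong_left letter_C tr_G0 slot_sum_mod less.hyps) simp_all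
    also have "\<dots> = 0"
      using slot_sum_diff[of "\<lambda>z. 0 :: 'g fa" "\<lambda>z. 0"] by simp
    finally show ?thesis .
  qed
qed

lemma phi_last_G0:
  assumes "x \<in> G0"
  shows "\<phi> (u @ [x]) \<doteq> \<phi> u * letter x"
proof (induction "length u" arbitrary: u rule: less_induct)
  case less
  show ?case
  proof (cases u)
    case Nil
    show ?thesis using assms by (simp add: Nil tr_on_G0)
  next
    case (Cons a u')
    have "\<phi> (u @ [x]) = letter (tr a) * \<phi> (u' @ [x]) +
      (slot_sum (\<lambda>z. \<phi> (z @ [x])) (ad a) u' + \<phi> (u' @ [kp (ad a x)]))"
      unfolding Cons by (simp add: slot_sum_append kp_br_G0 assms)
    also have "\<dots> \<doteq> letter (tr a) * (\<phi> u' * letter x) +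
      (slot_sum (\<lambda>z. \<phi> z * letter x) (ad a) u' + 0)"
      using Cons
      by (intro cong_add cong_left letter_C tr_G0 slot_sum_mod less.hyps phi_last_kp) simp_all
    also have "\<dots> = \<phi> u * letter x"
      unfolding Cons tri_word.simps slot_sum_mult_right distrib_right mult.assoc by simp
    finally show ?thesis .
  qed
qed

abbreviation \<Phi> :: "'g fa \<Rightarrow> 'g fa" where
  "\<Phi> \<equiv> linear_ext \<phi>"

lemma Phi_mult_induct:
  assumes "\<And>u. \<phi> (u @ [x]) \<doteq> \<phi> u * b" "b \<in> C"
  shows "\<Phi> (p * letter x) \<doteq> \<Phi> p * b"
proof (induction p rule: poly_mapping_single_induct)
  case (single w c)
  have "\<Phi> (Poly_Mapping.single w c * letter x) = scal c * \<phi> (letters w @ [x])"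
    unfolding single_eq_scal_word_mon[of w c] mult.assoc linear_ext_scal
    using linear_ext_word_mon[of \<phi> "letters w @ [x]"]
    by (simp only: word_mon_append word_mon_single)
  also have "\<dots> \<doteq> scal c * (\<phi> (letters w) * b)"
    by (intro cong_scal assms)
  finally show ?case by (simp add: linear_ext_single mult.assoc)
next
  case (add p q)
  then show ?case by (simp add: distrib_right linear_ext_add cong_add)
qed

lemma Phi_mult_G0: "x \<in> G0 \<Longrightarrow> \<Phi> (p * letter x) \<doteq> \<Phi> p * letter x"
  by (rule Phi_mult_induct[OF phi_last_G0 letter_C])

lemma Phi_mult_kp: "\<Phi> (p * letter (kp x)) \<doteq> 0"
  using Phi_mult_induct[of "kp x" 0 p] phi_last_kp[of _ x] by (simp add: zero_C)

lemma Phi_relation: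
  assumes "\<And>u v. \<Phi> (word_mon u * r * word_mon v) \<doteq> 0"
  shows "\<Phi> (a * r * b) \<doteq> 0"
proof -
  have *: "\<Phi> (word_mon u * r * b) \<doteq> 0" for u
  proof (induction b rule: poly_mapping_single_induct)
    case (single w c)
    have "\<Phi> (word_mon u * r * Poly_Mapping.single w c) = scal c * \<Phi> (word_mon u * r * word_mon (letters w))"
      unfolding single_eq_scal_word_mon[of w c] scal_left_commute linear_ext_scal ..
    also have "\<dots> \<doteq> scal c * 0" by (intro cong_scal assms)
    finally show ?case by simp
  next
    case (add p q)
    from cong_add[OF this] show ?case by (simp add: distrib_left linear_ext_add)
  qed
  show ?thesis
  proof (induction a rule: poly_mapping_single_induct)
    case (single w c)
    have "\<Phi> (Poly_Mapping.single w c * r * b) = scal c * \<Phi> (word_mon (letters w) * r * b)"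
      unfolding single_eq_scal_word_mon[of w c] mult.assoc linear_ext_scal ..
    also have "\<dots> \<doteq> scal c * 0" by (intro cong_scal *)
    finally show ?case by simp
  next
    case (add p q)
    from cong_add[OF this] show ?case by (simp add: distrib_right linear_ext_add)
  qed
qed

lemma Phi_word3: "\<Phi> (word_mon u * word_mon m * word_mon v) = \<phi> (u @ m @ v)"
  using linear_ext_word_mon[of \<phi> "u @ m @ v"] by (simp only: word_mon_append mult.assoc)

text \<open>
  The relations are respected for all letters, so the subset \<open>G\<close> that they are taken from is
  arbitrary.
\<close>

lemma Phi_uea_relations:
  assumes r: "r \<in> uea_relations G sc br"
  shows "\<Phi> (a * r * b) \<doteq> 0"
proof (rule Phi_relation)
  fix u v
  let ?F = "\<lambda>r. \<Phi> (word_mon u * r * word_mon v)"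
  have F: "?F (p + q) = ?F p + ?F q" "?F (p - q) = ?F p - ?F q" "?F (scal c * p) = scal c * ?F p"
    for p q c
    by (simp_all add: distrib_left distrib_right left_diff_distrib right_diff_distrib
        linear_ext_add linear_ext_diff mult.assoc scal_left_commute[of "word_mon u"] linear_ext_scal)
  have w: "?F (letter x) = \<phi> (u @ x # v)" "?F (letter x * letter y) = \<phi> (u @ x # y # v)" for x y
    using Phi_word3[of u "[x]" v] Phi_word3[of u "[x, y]" v]
    by (simp_all add: word_mon_Cons word_mon_Nil)
  from r consider
      x y where "r = letter (x + y) - (letter x + letter y)"
    | c x where "r = letter (sc c x) - scal c * letter x"
    | x y where "r = letter x * letter y - letter y * letter x - letter (br x y)"
    unfolding uea_relations_def by blast
  then show "?F r \<doteq> 0"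
  proof cases
    case 1
    then show ?thesis using phi_add[of u x y v] unfolding 1 F w by (simp add: cong_def)
  next
    case (2 c x)
    have "\<phi> (u @ (0 + sc c x) # v) \<doteq> 0 + scal c * \<phi> (u @ x # v)"
      by (intro cong_trans[OF phi_linear] cong_add phi_zero cong_refl)
    then show ?thesis unfolding 2 F w by (simp add: cong_def)
  next
    case 3
    show ?thesis using phi_bracket[of u _ _ v] unfolding 3 F w by (simp add: cong_def)
  qed
qed

end

section \<open>Quotients of free algebras\<close>

lemma carrier_free_alg_iff:
  "p \<in> carrier (free_alg G) \<longleftrightarrow> (\<forall>w\<in>Poly_Mapping.keys p. set (letters w) \<subseteq> G)"
  by (simp add: free_alg_def)

lemma free_alg_simps:
  "mult (free_alg G) = (*)" "one (free_alg G) = 1" "zero (free_alg G) = 0"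
  "add (free_alg G) = (+)" "smult (free_alg G) = (\<lambda>c p. scal c * p)"
  by (simp_all add: free_alg_def)

lemma single_in_free_alg:
  "set (letters w) \<subseteq> G \<Longrightarrow> Poly_Mapping.single w c \<in> carrier (free_alg G)"
  by (simp add: carrier_free_alg_iff)

lemma scal_in_free_alg: "scal c \<in> carrier (free_alg G)"
  by (simp add: single_in_free_alg zero_word_def)

lemma letter_in_free_alg: "x \<in> G \<Longrightarrow> letter x \<in> carrier (free_alg G)"
  by (simp add: letter_def single_in_free_alg)

lemma add_in_free_alg:
  "p \<in> carrier (free_alg G) \<Longrightarrow> q \<in> carrier (free_alg G) \<Longrightarrow> p + q \<in> carrier (free_alg G)"
  using keys_add[of p q] by (auto simp: carrier_free_alg_iff)

lemma mult_in_free_alg: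
  "p \<in> carrier (free_alg G) \<Longrightarrow> q \<in> carrier (free_alg G) \<Longrightarrow> p * q \<in> carrier (free_alg G)"
  using keys_mult[of p q] by (fastforce simp: carrier_free_alg_iff plus_word_def)

lemma uminus_in_free_alg: "p \<in> carrier (free_alg G) \<Longrightarrow> - p \<in> carrier (free_alg G)"
  using mult_in_free_alg[OF scal_in_free_alg[of "-1"], of p] by (simp add: single_uminus)

lemma diff_in_free_alg:
  "p \<in> carrier (free_alg G) \<Longrightarrow> q \<in> carrier (free_alg G) \<Longrightarrow> p - q \<in> carrier (free_alg G)"
  using add_in_free_alg[of p G "- q"] uminus_in_free_alg[of q] by simp

lemmas free_alg_closed = scal_in_free_alg letter_in_free_alg add_in_free_alg mult_in_free_alg
  uminus_in_free_alg diff_in_free_alg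

lemma ring_free_alg: "ring (free_alg G)"
proof (rule ringI)
  show "abelian_group (free_alg G)"
  proof (rule abelian_groupI)
    fix p assume "p \<in> carrier (free_alg G)"
    then show "\<exists>q\<in>carrier (free_alg G). q \<oplus>\<^bsub>free_alg G\<^esub> p = \<zero>\<^bsub>free_alg G\<^esub>"
      by (intro bexI[of _ "- p"] uminus_in_free_alg) (simp_all add: free_alg_simps)
  qed (use scal_in_free_alg[of 0] in \<open>auto simp: free_alg_simps add_in_free_alg ac_simps\<close>)
  show "Group.monoid (free_alg G)"
    using scal_in_free_alg[of 1]
    by (intro monoidI) (auto simp: free_alg_simps mult_in_free_alg mult.assoc)
qed (auto simp: free_alg_simps distrib_left distrib_right)

locale free_alg_ideal = ideal I "free_alg G" for I :: "'g fa set" and G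
begin

abbreviation "Q \<equiv> quot_algebra (free_alg G) I"

text \<open>The residue class of \<open>p\<close>.\<close>

definition cl :: "'g fa \<Rightarrow> 'g fa set" where
  "cl p = I +>\<^bsub>free_alg G\<^esub> p"

sublocale subalgebra_ideal "carrier (free_alg G)" I
proof
  show "0 \<in> I" using additive_subgroup.zero_closed[OF is_additive_subgroup]
    by (simp add: free_alg_simps)
  show "p + q \<in> I" if "p \<in> I" "q \<in> I" for p q
    using additive_subgroup.a_closed[OF is_additive_subgroup that]
    by (simp add: free_alg_simps)
  show "p * q \<in> I" if "p \<in> carrier (free_alg G)" "q \<in> I" for p q
    using I_l_closed[OF that(2,1)] by (simp add: free_alg_simps)
  show "q * p \<in> I" if "p \<in> carrier (free_alg G)" "q \<in> I" for p q
    using I_r_closed[OF that(2,1)] by (simp add: free_alg_simps)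
qed (auto intro: free_alg_closed)

lemma cl_eq: "cl p = {h + p | h. h \<in> I}"
  by (auto simp: cl_def a_r_coset_def r_coset_def free_alg_simps)

lemma cl_eq_iff: "cl p = cl q \<longleftrightarrow> p \<doteq> q"
proof
  assume "cl p = cl q"
  then have "p \<in> cl q" using zero_I by (force simp: cl_eq)
  then show "p \<doteq> q" by (auto simp: cl_eq cong_def)
next
  have "cl p \<subseteq> cl q" if "p \<doteq> q" for p q
  proof
    fix t assume "t \<in> cl p"
    then obtain h where "t = h + p" "h \<in> I" by (auto simp: cl_eq)
    with that show "t \<in> cl q"
      by (auto simp: cl_eq cong_def intro!: exI[of _ "h + (p - q)"] add_I)
  qed
  moreover assume "p \<doteq> q"
  ultimately show "cl p = cl q" using cong_sym by blast
qed

lemma carrier_Q: "carrier Q = cl ` carrier (free_alg G)"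
  by (auto simp: quot_algebra_def FactRing_def A_RCOSETS_def RCOSETS_def cl_def a_r_coset_def)

lemma cl_in_carrier: "p \<in> carrier (free_alg G) \<Longrightarrow> cl p \<in> carrier Q"
  by (simp add: carrier_Q)

lemma cl_one: "\<one>\<^bsub>Q\<^esub> = cl 1"
  by (simp add: quot_algebra_def FactRing_def cl_def free_alg_simps)

lemma cl_zero: "\<zero>\<^bsub>Q\<^esub> = cl 0"
  by (simp add: quot_algebra_def FactRing_def cl_eq)

lemma cl_add:
  assumes "p \<in> carrier (free_alg G)" "q \<in> carrier (free_alg G)"
  shows "cl p \<oplus>\<^bsub>Q\<^esub> cl q = cl (p + q)"
  using a_rcos_sum[OF assms]
  by (simp add: quot_algebra_def FactRing_def cl_def free_alg_simps)

lemma cl_mult: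
  assumes "p \<in> carrier (free_alg G)" "q \<in> carrier (free_alg G)"
  shows "cl p \<otimes>\<^bsub>Q\<^esub> cl q = cl (p * q)"
  using rcoset_mult_add[OF assms]
  by (simp add: quot_algebra_def FactRing_def cl_def free_alg_simps)

lemma cl_smult: "c \<odot>\<^bsub>Q\<^esub> cl p = cl (scal c * p)"
proof -
  have "c \<odot>\<^bsub>Q\<^esub> cl p = (\<Union>x\<in>cl p. cl (scal c * x))"
    by (simp add: quot_algebra_def cl_def free_alg_simps)
  also have "\<dots> = (\<Union>x\<in>cl p. cl (scal c * p))"
  proof (rule SUP_cong[OF refl])
    fix x assume "x \<in> cl p"
    then show "cl (scal c * x) = cl (scal c * p)"
      unfolding cl_eq_iff by (intro cong_scal) (auto simp: cl_eq cong_def)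
  qed
  also have "\<dots> = cl (scal c * p)" using zero_I by (auto simp: cl_eq)
  finally show ?thesis .
qed

lemma abelian_monoid_Q: "abelian_monoid Q"
proof (rule abelian_monoidI)
  have z: "0 \<in> carrier (free_alg G)" by (rule zero_C)
  show "\<zero>\<^bsub>Q\<^esub> \<in> carrier Q"
    by (simp add: cl_zero cl_in_carrier z)
qed (auto simp: carrier_Q cl_add cl_zero zero_C add_C ac_simps)

lemma finsum_cl:
  assumes "\<And>x. x \<in> A \<Longrightarrow> f x \<in> carrier (free_alg G)" "finite A"
  shows "finsum Q (\<lambda>x. cl (f x)) A = cl (\<Sum>x\<in>A. f x)"
  using assms(2,1)
proof induction
  case empty
  show ?case using abelian_monoid.finsum_empty[OF abelian_monoid_Q] by (simp add: cl_zero)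
next
  case (insert x A)
  then show ?case
    by (subst abelian_monoid.finsum_insert[OF abelian_monoid_Q])
      (auto simp: cl_in_carrier cl_add sum_C)
qed

lemma list_prod_cl:
  assumes "set ps \<subseteq> carrier (free_alg G)"
  shows "list_prod Q (map cl ps) = cl (prod_list ps) \<and> prod_list ps \<in> carrier (free_alg G)"
  using assms by (induction ps) (auto simp: list_prod_def cl_one cl_mult mult_C one_C)

end

lemma uea_relations_subset:
  assumes "\<And>x y. x \<in> G \<Longrightarrow> y \<in> G \<Longrightarrow> x + y \<in> G"
    and "\<And>c x. x \<in> G \<Longrightarrow> sc c x \<in> G"
    and "\<And>x y. x \<in> G \<Longrightarrow> y \<in> G \<Longrightarrow> br x y \<in> G"
  shows "uea_relations G sc br \<subseteq> carrier (free_alg G)"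
  unfolding uea_relations_def using assms by (auto intro!: free_alg_closed)

lemma uea_ideal_minimal:
  assumes "ideal J (free_alg G)" "uea_relations G sc br \<subseteq> J"
  shows "uea_ideal G sc br \<subseteq> J"
  unfolding uea_ideal_def by (rule ring.genideal_minimal[OF ring_free_alg assms])

section \<open>Matrices with a distinguished last row\<close>

context complex_algebra
begin

lemma gl_closed:
  "x \<in> gl N \<Longrightarrow> y \<in> gl N \<Longrightarrow> x + y \<in> gl N"
  "x \<in> gl N \<Longrightarrow> gl_scale scale c x \<in> gl N"
  "x \<in> gl N \<Longrightarrow> y \<in> gl N \<Longrightarrow> gl_bracket n x y \<in> gl N"
  by (auto simp: gl_def gl_scale_def gl_bracket_def plus_fun_def intro!: sum.neutral)

lemma ideal_U_ideal: "ideal (U_ideal scale N) (free_alg (gl N))"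
  unfolding U_ideal_def uea_ideal_def
  by (intro ring.genideal_ideal ring_free_alg uea_relations_subset gl_closed)

end

text \<open>
  The product of \<open>N \<times> N\<close> matrices; the entries of the factors with a row or column index
  outside \<open>{1..N}\<close> may be arbitrary, and associativity still holds.
\<close>

definition mat_mult :: "nat \<Rightarrow> ('w::ring) mat \<Rightarrow> 'w mat \<Rightarrow> 'w mat" where
  "mat_mult N A B = (\<lambda>i j. \<Sum>k = 1..N. A i k * B k j)"

lemma gl_bracket_mat_mult: "gl_bracket N A B = mat_mult N A B - mat_mult N B A"
  by (simp add: gl_bracket_def mat_mult_def fun_eq_iff sum_subtractf)

lemma mat_mult_assoc: "mat_mult N (mat_mult N A B) D = mat_mult N A (mat_mult N B D)"
proof (intro ext)
  fix i j
  have "mat_mult N (mat_mult N A B) D i j = (\<Sum>k=1..N. \<Sum>l=1..N. A i l * B l k * D k j)"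
    by (simp add: mat_mult_def sum_distrib_right)
  also have "\<dots> = (\<Sum>l=1..N. \<Sum>k=1..N. A i l * B l k * D k j)"
    by (rule sum.swap)
  also have "\<dots> = mat_mult N A (mat_mult N B D) i j"
    by (simp add: mat_mult_def sum_distrib_left mult.assoc)
  finally show "mat_mult N (mat_mult N A B) D i j = mat_mult N A (mat_mult N B D) i j" .
qed

lemma mat_mult_add:
  "mat_mult N (A + B) D = mat_mult N A D + mat_mult N B D"
  "mat_mult N D (A + B) = mat_mult N D A + mat_mult N D B"
  by (simp_all add: mat_mult_def fun_eq_iff sum.distrib distrib_left distrib_right)

lemma mat_mult_diff:
  "mat_mult N (A - B) D = mat_mult N A D - mat_mult N B D"
  "mat_mult N D (A - B) = mat_mult N D A - mat_mult N D B"
  by (simp_all add: mat_mult_def fun_eq_iff sum_subtractf left_diff_distrib right_diff_distrib)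

lemma gl_bracket_jacobi:
  "gl_bracket N x (gl_bracket N y z) =
    gl_bracket N (gl_bracket N x y) z + gl_bracket N y (gl_bracket N x z)"
  by (simp add: gl_bracket_mat_mult mat_mult_diff mat_mult_assoc)

text \<open>The upper left \<open>N \<times> N\<close> block of a matrix, padded by zeros.\<close>

definition corner :: "nat \<Rightarrow> ('w::zero) mat \<Rightarrow> 'w mat" where
  "corner N A = (\<lambda>i j. if i \<in> {1..N} \<and> j \<in> {1..N} then A i j else 0)"

text \<open>The part of an \<open>M \<times> M\<close> matrix in row \<open>M\<close>, the corner entry included.\<close>

definition last_row :: "nat \<Rightarrow> ('w::zero) mat \<Rightarrow> 'w mat" where
  "last_row M A = (\<lambda>i j. if i = M \<and> j \<in> {1..M} then A i j else 0)"

lemma corner_gl: "corner N A \<in> gl N"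
  by (auto simp: gl_def corner_def)

lemma mat_mult_last_row_left:
  "mat_mult M (last_row M A) B i j = (if i = M then mat_mult M A B i j else 0)"
  by (auto simp: mat_mult_def last_row_def intro!: sum.cong)

lemma mat_mult_last_row_right:
  fixes A :: "('w::ring) mat"
  assumes "1 \<le> M"
  shows "mat_mult M B (last_row M A) i j = (if j \<in> {1..M} then B i M * A M j else 0)"
proof -
  have "mat_mult M B (last_row M A) i j = 
     (\<Sum>k=1..M. if k = M then (if j \<in> {1..M} then B i M * A M j else 0) else 0)"
    unfolding mat_mult_def last_row_def by (rule sum.cong) auto
  then show ?thesis using assms by simp
qed

lemma mat_mult_Suc: "mat_mult (Suc N) A B i j = mat_mult N A B i j + A i (Suc N) * B (Suc N) j"
  by (simp add: mat_mult_def)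

lemma mat_mult_corner:
  "mat_mult N (corner N A) (corner N B) i j =
    (if i \<in> {1..N} \<and> j \<in> {1..N} then mat_mult N A B i j else 0)"
  by (auto simp: mat_mult_def corner_def intro!: sum.cong)

lemma last_row_reduced_bracket:
  assumes "1 \<le> M"
  shows "last_row M (gl_bracket M x y - gl_bracket M (last_row M x) y + gl_bracket M (last_row M y) x
    - gl_bracket M (last_row M y) (last_row M x)) = 0"
  using assms
  by (auto simp: fun_eq_iff gl_bracket_mat_mult last_row_def[of M "_ - _"] mat_mult_last_row_left
      mat_mult_last_row_right)

lemma corner_reduced_bracket:
  "corner N (gl_bracket (Suc N) x y - gl_bracket (Suc N) (last_row (Suc N) x) y
      + gl_bracket (Suc N) (last_row (Suc N) y) x
      - gl_bracket (Suc N) (last_row (Suc N) y) (last_row (Suc N) x))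
    = gl_bracket N (corner N x) (corner N y)"
  by (auto simp: fun_eq_iff gl_bracket_mat_mult corner_def[of N "_ - _"] mat_mult_last_row_left
      mat_mult_last_row_right mat_mult_corner mat_mult_Suc[of N x y] mat_mult_Suc[of N y x])

lemma last_row_bracket_last_row:
  assumes "1 \<le> M"
  shows "last_row M (gl_bracket M (last_row M x) (last_row M y))
    = gl_bracket M (last_row M x) (last_row M y)"
  using assms
  by (auto simp: fun_eq_iff gl_bracket_mat_mult last_row_def[of M "_ - _"] mat_mult_last_row_left
      mat_mult_last_row_right)

lemma last_row_bracket_gl:
  assumes "x \<in> gl N"
  shows "last_row (Suc N) (gl_bracket (Suc N) (last_row (Suc N) a) x)
    = gl_bracket (Suc N) (last_row (Suc N) a) x"
proof -
  have 0: "mat_mult (Suc N) a x i j = 0" if "j \<notin> {1..Suc N}" for i j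
    using assms that unfolding mat_mult_def gl_def by (intro sum.neutral) auto
  have "x i (Suc N) = 0" for i using assms by (auto simp: gl_def)
  then show ?thesis
    using 0 by (auto simp: fun_eq_iff gl_bracket_mat_mult last_row_def[of _ "_ - _"]
       mat_mult_last_row_left mat_mult_last_row_right)
qed

context complex_algebra
begin

lemma mat_mult_scale:
  "mat_mult N (gl_scale scale c A) B = gl_scale scale c (mat_mult N A B)"
  "mat_mult N A (gl_scale scale c B) = gl_scale scale c (mat_mult N A B)"
  by (simp_all add: mat_mult_def gl_scale_def fun_eq_iff scale_sum_right
      scale_mult_left flip: scale_mult_right)

lemma gl_scale_diff: "gl_scale scale c (A - B) = gl_scale scale c A - gl_scale scale c B"
  by (simp add: gl_scale_def fun_eq_iff scale_right_diff_distrib)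

end

text \<open>
  The triangular decomposition of \<open>gl (N + 1)\<close>: \<open>G0\<close> is \<open>gl N\<close>, \<open>k\<close> is the last row, and \<open>n\<close> is the
  last column without the corner entry.  On matrices with further nonzero entries, \<open>n\<close> is the
  common kernel of \<open>corner N\<close> and \<open>last_row (N + 1)\<close>.
\<close>

locale gl_level = complex_algebra scale
  for scale :: "complex \<Rightarrow> 'w::ring \<Rightarrow> 'w" +
  fixes N :: nat
begin

sublocale lower: free_alg_ideal "U_ideal scale N" "gl N"
  by (simp add: free_alg_ideal_def ideal_U_ideal)

lemma uea_relations_U_ideal:
  "uea_relations (gl N) (gl_scale scale) (gl_bracket N) \<subseteq> U_ideal scale N"
  unfolding U_ideal_def uea_ideal_def
  by (intro ring.genideal_self ring_free_alg uea_relations_subset gl_closed)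

lemma cong_letter_add:
  assumes "x \<in> gl N" "y \<in> gl N"
  shows "lower.cong (letter (x + y)) (letter x + letter y)"
  unfolding lower.cong_def using assms
  by (intro subsetD[OF uea_relations_U_ideal]) (unfold uea_relations_def, blast)

lemma cong_letter_scale:
  assumes "x \<in> gl N"
  shows "lower.cong (letter (gl_scale scale c x)) (scal c * letter x)"
  unfolding lower.cong_def using assms
  by (intro subsetD[OF uea_relations_U_ideal]) (unfold uea_relations_def, blast)

lemma cong_letter_bracket:
  assumes "x \<in> gl N" "y \<in> gl N"
  shows "lower.cong (letter x * letter y - letter y * letter x) (letter (gl_bracket N x y))"
  unfolding lower.cong_def using assms
  by (intro subsetD[OF uea_relations_U_ideal]) (unfold uea_relations_def, blast)

sublocale lower: triangular_projection "carrier (free_alg (gl N))" "U_ideal scale N" "gl N"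
  "gl_scale scale" "gl_bracket (Suc N)" "gl_bracket N" "corner N" "last_row (Suc N)"
proof
  fix x y z a :: "'w mat" and c
  show "lower.cong (letter (x + gl_scale scale c y)) (letter x + scal c * letter y)"
    if "x \<in> gl N" "y \<in> gl N"
    using that
    by (intro lower.cong_trans[OF cong_letter_add] lower.cong_add cong_letter_scale gl_closed)
      simp_all
  show "lower.cong (letter x * letter y - letter y * letter x) (letter (gl_bracket N x y))"
    if "x \<in> gl N" "y \<in> gl N"
    using that by (rule cong_letter_bracket)
  show "gl_bracket (Suc N) (x + gl_scale scale c y) z =
      gl_bracket (Suc N) x z + gl_scale scale c (gl_bracket (Suc N) y z)"
    by (simp add: gl_bracket_mat_mult mat_mult_add mat_mult_scale gl_scale_diff)
  show "gl_bracket (Suc N) z (x + gl_scale scale c y) =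
      gl_bracket (Suc N) z x + gl_scale scale c (gl_bracket (Suc N) z y)"
    by (simp add: gl_bracket_mat_mult mat_mult_add mat_mult_scale gl_scale_diff)
  show "letter x \<in> carrier (free_alg (gl N))" if "x \<in> gl N"
    using that by (rule letter_in_free_alg)
  show "corner N (last_row (Suc N) x) = 0"
    by (auto simp: corner_def last_row_def fun_eq_iff)
  show "corner N x = x" if "x \<in> gl N"
    using that by (auto simp: corner_def gl_def fun_eq_iff)
  show "last_row (Suc N) (gl_bracket (Suc N) (last_row (Suc N) a) x) =
      gl_bracket (Suc N) (last_row (Suc N) a) x" if "x \<in> gl N"
    using that by (rule last_row_bracket_gl)
  show "gl_bracket (Suc N) x (gl_bracket (Suc N) y z) = gl_bracket (Suc N) (gl_bracket (Suc N) x y) z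
      + gl_bracket (Suc N) y (gl_bracket (Suc N) x z)"
    by (rule gl_bracket_jacobi)
  show "gl_scale scale 1 x = x" by (simp add: gl_scale_def)
  show "corner N x \<in> gl N" by (rule corner_gl)
  show "corner N (x + gl_scale scale c y) = corner N x + gl_scale scale c (corner N y)"
    by (auto simp: corner_def gl_scale_def fun_eq_iff)
  show "last_row (Suc N) (x + gl_scale scale c y) =
      last_row (Suc N) x + gl_scale scale c (last_row (Suc N) y)"
    by (auto simp: last_row_def gl_scale_def fun_eq_iff)
qed (simp_all only: corner_reduced_bracket last_row_reduced_bracket
    last_row_bracket_last_row One_nat_def Suc_le_mono le0)

end

section \<open>Sums over compositions\<close>

lemma compositions_Suc_0: "compositions (Suc 0) = {[1]}"
proof
  show "compositions (Suc 0) \<subseteq> {[1]}"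
  proof
    fix \<nu> assume \<nu>: "\<nu> \<in> compositions (Suc 0)"
    then show "\<nu> \<in> {[1]}"
      by (cases \<nu>; cases "tl \<nu>") (auto simp: compositions_def add_is_1)
  qed
qed (auto simp: compositions_def)

text \<open>The first part of a composition is either 1, or it can be decreased by 1.\<close>

lemma compositions_Suc_Suc:
  "compositions (Suc (Suc m)) =
    (#) 1 ` compositions (Suc m) \<union> (\<lambda>\<nu>. Suc (hd \<nu>) # tl \<nu>) ` compositions (Suc m)"
    (is "_ = ?A \<union> ?B")
proof
  show "compositions (Suc (Suc m)) \<subseteq> ?A \<union> ?B"
  proof
    fix \<nu> assume \<nu>: "\<nu> \<in> compositions (Suc (Suc m))"
    then obtain n \<nu>' where n: "\<nu> = n # \<nu>'" by (cases \<nu>) (auto simp: compositions_def)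
    show "\<nu> \<in> ?A \<union> ?B"
    proof (cases "n = 1")
      case True
      then show ?thesis using \<nu> n by (auto simp: compositions_def)
    next
      case False
      then have "(n - 1) # \<nu>' \<in> compositions (Suc m)" "\<nu> = Suc (n - 1) # \<nu>'"
        using \<nu> n by (auto simp: compositions_def)
      then show ?thesis by (intro UnI2 image_eqI[of _ _ "(n - 1) # \<nu>'"]) simp_all
    qed
  qed
  show "?A \<union> ?B \<subseteq> compositions (Suc (Suc m))"
  proof (intro Un_least image_subsetI)
    fix \<nu> assume \<nu>: "\<nu> \<in> compositions (Suc m)"
    then show "1 # \<nu> \<in> compositions (Suc (Suc m))" by (simp add: compositions_def)
    from \<nu> show "Suc (hd \<nu>) # tl \<nu> \<in> compositions (Suc (Suc m))"
      by (cases \<nu>) (simp_all add: compositions_def)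
  qed
qed

lemma finite_compositions: "finite (compositions (Suc m))"
  by (induction m) (simp_all only: compositions_Suc_0 compositions_Suc_Suc finite_Un
      finite_imageI finite.intros simp_thms)

lemma composition_neq_Nil: "\<nu> \<in> compositions (Suc m) \<Longrightarrow> \<nu> \<noteq> []"
  by (auto simp: compositions_def)

lemma sum_compositions_Suc_Suc:
  fixes f :: "nat list \<Rightarrow> 'b::comm_monoid_add"
  shows "(\<Sum>\<nu>\<in>compositions (Suc (Suc m)). f \<nu>) =
    (\<Sum>\<nu>\<in>compositions (Suc m). f (1 # \<nu>)) +
    (\<Sum>\<nu>\<in>compositions (Suc m). f (Suc (hd \<nu>) # tl \<nu>))"
proof -
  have inj: "inj_on (\<lambda>\<nu>. Suc (hd \<nu>) # tl \<nu>) (compositions (Suc m))"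
    using composition_neq_Nil by (auto simp: inj_on_def intro: list.expand)
  have "1 # \<nu> \<noteq> Suc (hd \<mu>) # tl \<mu>" if "\<mu> \<in> compositions (Suc m)" for \<mu> \<nu>
    using that by (cases \<mu>) (auto simp: compositions_def)
  then have disj: "(#) 1 ` compositions (Suc m) \<inter> (\<lambda>\<nu>. Suc (hd \<nu>) # tl \<nu>) ` compositions (Suc m) = {}"
    by blast
  show ?thesis
    unfolding compositions_Suc_Suc
    by (subst sum.union_disjoint)
      (use disj inj in \<open>auto simp: finite_compositions sum.reindex\<close>)
qed

lemma length_coarsen: "length (coarsen xs \<nu>) = length \<nu>"
  by (induction xs \<nu> rule: coarsen.induct) auto

lemma coarsen_neq_Nil: "\<nu> \<noteq> [] \<Longrightarrow> coarsen xs \<nu> \<noteq> []"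
  using length_coarsen[of xs \<nu>] by auto

lemma composition_length:
  assumes "\<nu> \<in> compositions m"
  shows "length \<nu> \<le> m"
proof -
  have "0 \<notin> set \<nu> \<Longrightarrow> length \<nu> \<le> sum_list \<nu>" by (induction \<nu>) auto
  then show ?thesis using assms by (auto simp: compositions_def)
qed

lemma coarsen_merge:
  assumes "\<nu> \<in> compositions (Suc m)"
  shows "coarsen (x # y # ys) (Suc (hd \<nu>) # tl \<nu>) = coarsen (x * y # ys) \<nu>"
proof -
  from assms obtain n \<mu> where \<nu>: "\<nu> = Suc n # \<mu>"
    by (cases \<nu>) (auto simp: compositions_def gr0_conv_Suc)
  show ?thesis by (simp add: \<nu>)
qed

text \<open>
  The sum of \<open>z ^ (length xs - length ys) * f ys\<close> over the coarsenings \<open>ys\<close> of \<open>xs\<close>, organised according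
  to whether the first two entries of \<open>xs\<close> are multiplied.
\<close>

function merge_sum :: "complex \<Rightarrow> ('w::ring list \<Rightarrow> 'g fa) \<Rightarrow> 'w list \<Rightarrow> 'g fa" where
  "merge_sum z f [] = f []"
| "merge_sum z f [x] = f [x]"
| "merge_sum z f (x # y # ys) =
    merge_sum z (\<lambda>l. f (x # l)) (y # ys) + scal z * merge_sum z f (x * y # ys)"
  by pat_completeness auto
termination by (relation "measure (\<lambda>(z, f, xs). length xs)") auto

lemma merge_sum_eq_sum_compositions:
  assumes "xs \<noteq> []"
  shows "(\<Sum>\<nu>\<in>compositions (length xs). scal (z ^ (length xs - length (coarsen xs \<nu>))) * f (coarsen xs \<nu>))
    = merge_sum z f xs"
  using assms
proof (induction z f xs rule: merge_sum.induct)
  case (3 z f x y ys)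
  let ?m = "Suc (length ys)"
  let ?F = "\<lambda>\<nu>. scal (z ^ (Suc ?m - length \<nu>)) * f (coarsen (x # y # ys) \<nu>)"
  have "(\<Sum>\<nu>\<in>compositions ?m. ?F (1 # \<nu>)) = merge_sum z (\<lambda>l. f (x # l)) (y # ys)"
    using "3.IH"(1) by (simp add: length_coarsen)
  moreover have "(\<Sum>\<nu>\<in>compositions ?m. ?F (Suc (hd \<nu>) # tl \<nu>)) =
      (\<Sum>\<nu>\<in>compositions ?m. scal z * (scal (z ^ (?m - length \<nu>)) * f (coarsen (x * y # ys) \<nu>)))"
  proof (rule sum.cong[OF refl])
    fix \<nu> assume \<nu>: "\<nu> \<in> compositions ?m"
    have "z ^ (Suc ?m - length \<nu>) = z * z ^ (?m - length \<nu>)"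
      using composition_length[OF \<nu>] by (simp add: Suc_diff_le)
    moreover have "length (Suc (hd \<nu>) # tl \<nu>) = length \<nu>"
      using composition_neq_Nil[OF \<nu>] by simp
    ultimately show "?F (Suc (hd \<nu>) # tl \<nu>) =
        scal z * (scal (z ^ (?m - length \<nu>)) * f (coarsen (x * y # ys) \<nu>))"
      by (simp only: coarsen_merge[OF \<nu>] scal_mult mult.assoc)
  qed
  moreover have "\<dots> = scal z * merge_sum z f (x * y # ys)"
    using "3.IH"(2) by (simp add: length_coarsen flip: sum_distrib_left)
  ultimately show ?case
    by (simp only: length_coarsen list.size add_Suc_right add_0_right sum_compositions_Suc_Suc
        merge_sum.simps)
qed (auto simp: compositions_Suc_0)

lemma merge_sum_cong:
  assumes "xs \<noteq> []" "\<And>l. l \<noteq> [] \<Longrightarrow> f l = g l"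
  shows "merge_sum z f xs = merge_sum z g xs"
  using assms
proof (induction z f xs arbitrary: g rule: merge_sum.induct)
  case (3 z f x y ys)
  have "merge_sum z (\<lambda>l. f (x # l)) (y # ys) = merge_sum z (\<lambda>l. g (x # l)) (y # ys)"
    by (intro "3.IH"(1) "3.prems") simp_all
  moreover have "merge_sum z f (x * y # ys) = merge_sum z g (x * y # ys)"
    by (intro "3.IH"(2) "3.prems") simp_all
  ultimately show ?case by simp
qed simp_all

lemma merge_sum_linear:
  "merge_sum z (\<lambda>l. f l + scal c * g l) xs = merge_sum z f xs + scal c * merge_sum z g xs"
proof (induction z f xs arbitrary: g rule: merge_sum.induct)
  case (3 z f x y ys)
  show ?case
    unfolding merge_sum.simps "3.IH" distrib_left scal_left_commute[of "scal z" c]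
    by (simp only: ac_simps)
qed simp_all

lemma merge_sum_merge_head:
  "merge_sum z (\<lambda>l. g (x * hd l # tl l)) (y # ys) = merge_sum z g (x * y # ys)"
proof (induction "length ys" arbitrary: y ys g rule: less_induct)
  case less
  show ?case
  proof (cases ys)
    case (Cons y' ys')
    have "merge_sum z (\<lambda>l. g (x * hd l # tl l)) (y * y' # ys') = merge_sum z g (x * (y * y') # ys')"
      using Cons by (intro less) simp
    then show ?thesis by (simp add: Cons mult.assoc)
  qed simp
qed

text \<open>
  The operators \<open>merge_sum z\<close> form a one-parameter group.  This expresses \<open>t\<^bsub>ij\<^esub>(x;s+c)\<close> by the
  elements \<open>t\<^bsub>ij\<^esub>(y;s)\<close>.
\<close>

lemma merge_sum_merge_sum:
  assumes "xs \<noteq> []"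
  shows "merge_sum w (merge_sum z f) xs = merge_sum (w + z) f xs"
  using assms
proof (induction "length xs" arbitrary: xs f rule: less_induct)
  case less
  show ?case
  proof (cases "length xs = 1")
    case True
    then obtain x where "xs = [x]" by (cases xs) auto
    then show ?thesis by simp
  next
    case False
    then obtain x y ys where xs: "xs = x # y # ys"
      using less.prems by (cases xs; cases "tl xs") auto
    have "merge_sum z f (x # l) = merge_sum z (\<lambda>l. f (x # l)) l +
        scal z * merge_sum z f (x * hd l # tl l)" if "l \<noteq> []" for l
      using that by (cases l) auto
    then have "merge_sum w (\<lambda>l. merge_sum z f (x # l)) (y # ys) =
        merge_sum w (\<lambda>l. merge_sum z (\<lambda>l. f (x # l)) l + scal z * merge_sum z f (x * hd l # tl l)) (y # ys)"
      by (intro merge_sum_cong) simp_all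
    also have "\<dots> = merge_sum (w + z) (\<lambda>l. f (x # l)) (y # ys) + scal z * merge_sum (w + z) f (x * y # ys)"
      unfolding merge_sum_linear merge_sum_merge_head
      using less.hyps[of "y # ys" "\<lambda>l. f (x # l)"] less.hyps[of "x * y # ys" f]
      by (simp add: xs)
    moreover have "merge_sum w (merge_sum z f) (x * y # ys) = merge_sum (w + z) f (x * y # ys)"
      using less.hyps[of "x * y # ys" f] by (simp add: xs)
    ultimately show ?thesis
      by (simp add: xs single_add distrib_right add.assoc add.commute)
  qed
qed

section \<open>The generators and the projection between levels\<close>

text \<open>
  The representative of \<open>e\<^bsub>ij\<^esub>(xs;N)\<close> in the free algebra.  The fixed column index \<open>j\<close> comes before
  the row index \<open>i\<close>, which changes in the recursion.
\<close>

fun e_poly :: "nat \<Rightarrow> nat \<Rightarrow> nat \<Rightarrow> 'w::ring list \<Rightarrow> 'w mat fa" where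
  "e_poly N j i [] = 1"
| "e_poly N j i [x] = letter (mat_unit i j x)"
| "e_poly N j i (x # y # ys) = (\<Sum>a = 1..N. letter (mat_unit i a x) * e_poly N j a (y # ys))"

lemma mat_unit_gl: "i \<in> {1..N} \<Longrightarrow> j \<in> {1..N} \<Longrightarrow> mat_unit i j x \<in> gl N"
  by (auto simp: gl_def mat_unit_def)

text \<open>The monomial of \<open>e\<^bsub>ij\<^esub>(xs;N)\<close> for the tuple \<open>as\<close> of summation indices.\<close>

definition path_mon :: "nat \<Rightarrow> nat list \<Rightarrow> nat \<Rightarrow> 'w::ring list \<Rightarrow> 'w mat fa" where
  "path_mon i as j xs = prod_list (map (\<lambda>k. letter (mat_unit ((i # as @ [j]) ! k)
      ((i # as @ [j]) ! Suc k) (xs ! k))) [0..<length xs])"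

lemma path_mon_Cons:
  "path_mon i (a # as) j (x # xs) = letter (mat_unit i a x) * path_mon a as j xs"
proof -
  have "[0..<length (x # xs)] = 0 # map Suc [0..<length xs]"
    by (simp add: map_Suc_upt upt_conv_Cons del: upt_Suc)
  then show ?thesis
    by (simp add: path_mon_def comp_def del: upt_Suc)
qed

lemma path_mon_single: "path_mon i [] j [x] = letter (mat_unit i j x)"
  by (simp add: path_mon_def)

lemma sum_path_mon:
  assumes "xs \<noteq> []"
  shows "(\<Sum>as | length as = length xs - 1 \<and> set as \<subseteq> {1..N}. path_mon i as j xs) = e_poly N j i xs"
  using assms
proof (induction N j i xs rule: e_poly.induct)
  case (2 N j i x)
  have "{as. length as = 0 \<and> set as \<subseteq> {1..N}} = {[]}" by auto
  then show ?case by (simp add: path_mon_single)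
next
  case (3 N j i x y ys)
  let ?S = "\<lambda>n. {as. length as = n \<and> set as \<subseteq> {1..N}}"
  have S: "?S (Suc n) = (\<lambda>(a, as). a # as) ` ({1..N} \<times> ?S n)" for n
    by (auto simp: image_iff length_Suc_conv)
  have "(\<Sum>as\<in>?S (Suc (length ys)). path_mon i as j (x # y # ys)) =
    (\<Sum>(a, as)\<in>{1..N} \<times> ?S (length ys). letter (mat_unit i a x) * path_mon a as j (y # ys))"
    unfolding S by (subst sum.reindex) (auto simp: inj_on_def path_mon_Cons intro!: sum.cong)
  also have "\<dots> = (\<Sum>a=1..N. letter (mat_unit i a x) * e_poly N j a (y # ys))"
    using "3.IH" by (simp add: sum.cartesian_product[symmetric] sum_distrib_left[symmetric])
  finally show ?case by simp
qed simp

context gl_level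
begin

lemma U_eq: "U scale N = lower.Q"
  by (simp add: U_def uea_def U_ideal_def)

lemma E_eq: "E scale N i j x = lower.cl (letter (mat_unit i j x))"
  by (simp add: E_def U_of_def lower.cl_def)

lemma mat_unit_in_free: "i \<in> {1..N} \<Longrightarrow> j \<in> {1..N} \<Longrightarrow> letter (mat_unit i j x) \<in> carrier (free_alg (gl N))"
  by (intro letter_in_free_alg mat_unit_gl)

lemma e_poly_in_free:
  "i \<in> {1..N} \<Longrightarrow> j \<in> {1..N} \<Longrightarrow> e_poly N j i (xs :: 'w list) \<in> carrier (free_alg (gl N))"
proof (induction xs arbitrary: i rule: induct_list012)
  case (3 x y ys)
  then show ?case
    unfolding e_poly.simps by - (rule lower.sum_C, rule lower.mult_C, rule mat_unit_in_free, simp_all)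
qed (use mat_unit_in_free lower.one_C in simp_all)

lemma path_letters:
  assumes "i \<in> {1..N}" "j \<in> {1..N}" "set as \<subseteq> {1..N}" "length xs = Suc (length as)" "k < length xs"
  shows "letter (mat_unit ((i # as @ [j]) ! k) ((i # as @ [j]) ! Suc k) y)
    \<in> carrier (free_alg (gl N))"
proof -
  have "set (i # as @ [j]) \<subseteq> {1..N}" using assms by auto
  then have "(i # as @ [j]) ! l \<in> {1..N}" if "l < Suc (length xs)" for l
    using that assms(4) nth_mem[of l "i # as @ [j]"] by auto
  from this[of k] this[of "Suc k"] show ?thesis using assms(5)
    by (intro mat_unit_in_free) simp_all
qed

lemma e_gen_eq:
  assumes "i \<in> {1..N}" "j \<in> {1..N}" "xs \<noteq> []"
  shows "e_gen scale N i j xs = lower.cl (e_poly N j i xs)"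
proof -
  interpret Q: abelian_monoid lower.Q by (rule lower.abelian_monoid_Q)
  let ?S = "{as. length as = length xs - 1 \<and> set as \<subseteq> {1..N}}"
  have m: "list_prod lower.Q (map (\<lambda>k. E scale N ((i # as @ [j]) ! k) ((i # as @ [j]) ! Suc k) (xs ! k))
      [0..<length xs]) = lower.cl (path_mon i as j xs) \<and> path_mon i as j xs \<in> carrier (free_alg (gl N))"
    if "as \<in> ?S" for as
  proof -
    let ?ps = "map (\<lambda>k. letter (mat_unit ((i # as @ [j]) ! k) ((i # as @ [j]) ! Suc k) (xs ! k)))
      [0..<length xs]"
    have "length xs = Suc (length as)" using that assms(3) by (cases xs) auto
    with that have "set ?ps \<subseteq> carrier (free_alg (gl N))"
      unfolding set_map set_upt
      by - (rule image_subsetI, rule path_letters[OF assms(1,2), of as xs], simp_all)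
    from lower.list_prod_cl[OF this] show ?thesis
      unfolding path_mon_def E_eq map_map comp_def .
  qed
  have "finite ?S" using finite_lists_length_eq[of "{1..N}" "length xs - 1"]
    by (simp add: conj_commute)
  have "e_gen scale N i j xs = finsum lower.Q (\<lambda>as. lower.cl (path_mon i as j xs)) ?S"
    unfolding e_gen_def U_eq using m lower.cl_in_carrier by (intro Q.finsum_cong'[OF refl]) blast+
  also have "\<dots> = lower.cl (\<Sum>as\<in>?S. path_mon i as j xs)"
    using m \<open>finite ?S\<close> by (intro lower.finsum_cl) auto
  finally show ?thesis unfolding sum_path_mon[OF assms(3)] .
qed

lemma t_level_eq:
  assumes "i \<in> {1..N}" "j \<in> {1..N}" "xs \<noteq> []"
  shows "t_level scale N s i j xs = lower.cl (merge_sum (- of_nat N - s) (e_poly N j i) xs)"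
proof -
  interpret Q: abelian_monoid lower.Q by (rule lower.abelian_monoid_Q)
  obtain m where m: "length xs = Suc m" using assms(3) by (cases xs) auto
  let ?z = "- of_nat N - s :: complex"
  let ?p = "\<lambda>\<nu>. scal (?z ^ (length xs - length (coarsen xs \<nu>))) * e_poly N j i (coarsen xs \<nu>)"
  have p: "?p \<nu> \<in> carrier (free_alg (gl N))" for \<nu>
    by (intro lower.mult_C lower.scal_C e_poly_in_free assms)
  have "t_level scale N s i j xs = finsum lower.Q (\<lambda>\<nu>. lower.cl (?p \<nu>)) (compositions (length xs))"
    unfolding t_level_def U_eq m
  proof (rule Q.finsum_cong'[OF refl])
    show "(\<lambda>\<nu>. lower.cl (scal (?z ^ (Suc m - length (coarsen xs \<nu>))) * e_poly N j i (coarsen xs \<nu>)))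
        \<in> compositions (Suc m) \<rightarrow> carrier lower.Q"
      using lower.cl_in_carrier[OF p] by (simp add: m)
    fix \<nu> assume "\<nu> \<in> compositions (Suc m)"
    then have "coarsen xs \<nu> \<noteq> []" using coarsen_neq_Nil composition_neq_Nil by blast
    from e_gen_eq[OF assms(1,2) this]
    show "?z ^ (Suc m - length (coarsen xs \<nu>)) \<odot>\<^bsub>lower.Q\<^esub> e_gen scale N i j (coarsen xs \<nu>)
      = lower.cl (scal (?z ^ (Suc m - length (coarsen xs \<nu>))) * e_poly N j i (coarsen xs \<nu>))"
      by (simp only: lower.cl_smult)
  qed
  also have "\<dots> = lower.cl (\<Sum>\<nu>\<in>compositions (length xs). ?p \<nu>)"
    using p by (intro lower.finsum_cl) (simp_all add: m finite_compositions)
  finally show ?thesis using assms(3) by (simp add: merge_sum_eq_sum_compositions)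
qed

lemma mat_unit_last_row:
  "a \<in> {1..Suc N} \<Longrightarrow> last_row (Suc N) (mat_unit (Suc N) a x) = mat_unit (Suc N) a x"
  by (auto simp: last_row_def mat_unit_def fun_eq_iff)

lemma Phi_mult_last_row:
  "a \<in> {1..Suc N} \<Longrightarrow> lower.cong (lower.\<Phi> (p * letter (mat_unit (Suc N) a x))) 0"
  using lower.Phi_mult_kp[of p "mat_unit (Suc N) a x"] by (simp add: mat_unit_last_row)

text \<open>
  In the sum over the next matrix index \<open>a\<close>, the factor on the right is handled first, by the
  induction hypothesis.  For \<open>a = N + 1\<close> it is zero; for \<open>a \<le> N\<close> it leaves \<open>\<Phi>(p E\<^bsub>ia\<^esub>(x))\<close>, which is
  \<open>\<Phi>(p) E\<^bsub>ia\<^esub>(x)\<close> if \<open>i \<le> N\<close> and zero if \<open>i = N + 1\<close>.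
\<close>

lemma Phi_mult_e_poly:
  assumes "xs \<noteq> []" "j \<in> {1..N}"
  shows "lower.cong (lower.\<Phi> (p * e_poly (Suc N) j (Suc N) xs)) 0"
    and "i \<in> {1..N} \<Longrightarrow> lower.cong (lower.\<Phi> (p * e_poly (Suc N) j i xs)) (lower.\<Phi> p * e_poly N j i xs)"
  using assms(1)
proof (induction xs arbitrary: i p rule: list_nonempty_induct)
  case (single x)
  { case 1 show ?case using assms(2) Phi_mult_last_row by auto }
  { case 2 then show ?case using assms(2) lower.Phi_mult_G0[OF mat_unit_gl] by simp }
next
  case (cons x xs)
  then obtain y ys where xs: "xs = y # ys" by (cases xs) auto
  have split: "lower.\<Phi> (p * e_poly (Suc N) j i (x # xs)) =
      (\<Sum>a=1..N. lower.\<Phi> (p * letter (mat_unit i a x) * e_poly (Suc N) j a xs)) +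
      lower.\<Phi> (p * letter (mat_unit i (Suc N) x) * e_poly (Suc N) j (Suc N) xs)" for p i
    by (simp add: xs sum_distrib_left distrib_left mult.assoc linear_ext_add linear_ext_sum)
  { case 1
    have "lower.cong (lower.\<Phi> (p * e_poly (Suc N) j (Suc N) (x # xs))) ((\<Sum>a=1..N. 0) + 0)"
      unfolding split
    proof (rule lower.cong_add[OF lower.cong_sum cons.IH(1)])
      fix a assume a: "a \<in> {1..N}"
      have "lower.cong (lower.\<Phi> (p * letter (mat_unit (Suc N) a x) * e_poly (Suc N) j a xs))
         (lower.\<Phi> (p * letter (mat_unit (Suc N) a x)) * e_poly N j a xs)"
        by (rule cons.IH(2)[OF a])
      also have "lower.cong \<dots> (0 * e_poly N j a xs)"
        using a assms(2) by (intro lower.cong_right e_poly_in_free Phi_mult_last_row) auto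
      finally show "lower.cong (lower.\<Phi> (p * letter (mat_unit (Suc N) a x) * e_poly (Suc N) j a xs)) 0"
        by simp
    qed
    then show ?case by simp }
  { case 2
    have "lower.cong (lower.\<Phi> (p * e_poly (Suc N) j i (x # xs)))
      ((\<Sum>a=1..N. lower.\<Phi> p * letter (mat_unit i a x) * e_poly N j a xs) + 0)"
      unfolding split
    proof (rule lower.cong_add[OF lower.cong_sum cons.IH(1)])
      fix a assume a: "a \<in> {1..N}"
      have "lower.cong (lower.\<Phi> (p * letter (mat_unit i a x) * e_poly (Suc N) j a xs))
         (lower.\<Phi> (p * letter (mat_unit i a x)) * e_poly N j a xs)"
        by (rule cons.IH(2)[OF a])
      also have "lower.cong \<dots> (lower.\<Phi> p * letter (mat_unit i a x) * e_poly N j a xs)"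
        using a 2 assms(2) by (intro lower.cong_right e_poly_in_free lower.Phi_mult_G0 mat_unit_gl) auto
      finally show "lower.cong (lower.\<Phi> (p * letter (mat_unit i a x) * e_poly (Suc N) j a xs))
        (lower.\<Phi> p * letter (mat_unit i a x) * e_poly N j a xs)" .
    qed
    then show ?case by (simp add: xs sum_distrib_left mult.assoc) }
qed

lemma Phi_mult_merge_sum:
  assumes "xs \<noteq> []"
    and "\<And>p l. l \<noteq> [] \<Longrightarrow> lower.cong (lower.\<Phi> (p * f l)) (lower.\<Phi> p * g l)"
  shows "lower.cong (lower.\<Phi> (p * merge_sum z f xs)) (lower.\<Phi> p * merge_sum z g xs)"
  using assms
proof (induction "length xs" arbitrary: xs f g p rule: less_induct)
  case less
  show ?case
  proof (cases "length xs = 1")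
    case True
    then obtain x where "xs = [x]" by (cases xs) auto
    then show ?thesis using less.prems(2)[of "[x]"] by simp
  next
    case False
    then obtain x y ys where xs: "xs = x # y # ys"
      using less.prems by (cases xs; cases "tl xs") auto
    have "lower.\<Phi> (p * merge_sum z f xs) = lower.\<Phi> (p * merge_sum z (\<lambda>l. f (x # l)) (y # ys)) +
       scal z * lower.\<Phi> (p * merge_sum z f (x * y # ys))"
      by (simp only: xs merge_sum.simps distrib_left linear_ext_add scal_left_commute linear_ext_scal)
    also have "lower.cong \<dots> (lower.\<Phi> p * merge_sum z (\<lambda>l. g (x # l)) (y # ys) +
       scal z * (lower.\<Phi> p * merge_sum z g (x * y # ys)))"
      by (intro lower.cong_add lower.cong_scal less.hyps less.prems) (simp_all add: xs)
    also have "\<dots> = lower.\<Phi> p * merge_sum z g xs"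
      by (simp only: xs merge_sum.simps distrib_left scal_left_commute)
    finally show ?thesis .
  qed
qed

lemma Phi_U_ideal:
  assumes "p \<in> U_ideal scale (Suc N)"
  shows "lower.\<Phi> p \<in> U_ideal scale N"
proof -
  let ?R = "free_alg (gl (Suc N)) :: (complex, 'w mat fa) module"
  \<comment> \<open>The factors \<open>a\<close> and \<open>b\<close> make this set an ideal.\<close>
  let ?J = "{p \<in> carrier ?R. \<forall>a b. lower.\<Phi> (a * p * b) \<in> U_ideal scale N}"
  interpret R: ring ?R by (rule ring_free_alg)
  have "U_ideal scale (Suc N) \<subseteq> ?J"
    unfolding U_ideal_def[of scale "Suc N"]
  proof (rule uea_ideal_minimal)
    show "ideal ?J ?R"
    proof (rule idealI)
      show "subgroup ?J (add_monoid ?R)"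
      proof (rule R.add.subgroupI)
        have "0 \<in> ?J"
          using scal_in_free_alg[of 0 "gl (Suc N)"] lower.zero_I by (simp add: linear_ext_zero)
        then show "?J \<noteq> {}" by blast
        show "p \<oplus>\<^bsub>?R\<^esub> q \<in> ?J" if "p \<in> ?J" "q \<in> ?J" for p q
          using that by (auto simp: free_alg_simps add_in_free_alg distrib_left distrib_right
              linear_ext_add lower.add_I)
        fix p assume p: "p \<in> ?J"
        have "- p \<in> ?J"
          using p by (auto simp: uminus_in_free_alg linear_ext_uminus lower.uminus_I)
        moreover have "\<ominus>\<^bsub>?R\<^esub> p = - p"
          using p by (intro R.minus_equality) (auto simp: free_alg_simps uminus_in_free_alg)
        ultimately show "\<ominus>\<^bsub>?R\<^esub> p \<in> ?J" by simp
      qed auto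
      fix p q assume p: "p \<in> ?J" and q: "q \<in> carrier ?R"
      show "q \<otimes>\<^bsub>?R\<^esub> p \<in> ?J"
        using p q by (auto simp: free_alg_simps mult_in_free_alg simp flip: mult.assoc)
      have "lower.\<Phi> (a * (p * q) * b) \<in> U_ideal scale N" for a b
      proof -
        have "lower.\<Phi> (a * p * (q * b)) \<in> U_ideal scale N" using p by blast
        then show ?thesis by (simp only: mult.assoc)
      qed
      then show "p \<otimes>\<^bsub>?R\<^esub> q \<in> ?J"
        using p q by (simp add: free_alg_simps mult_in_free_alg)
    qed (rule ring_free_alg)
    show "uea_relations (gl (Suc N)) (gl_scale scale) (gl_bracket (Suc N)) \<subseteq> ?J"
      using uea_relations_subset[of "gl (Suc N)" "gl_scale scale" "gl_bracket (Suc N)"] gl_closed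
        lower.Phi_uea_relations[where G = "gl (Suc N)"] by (fastforce simp: lower.cong_0_iff)
  qed
  with assms have "lower.\<Phi> (1 * p * 1) \<in> U_ideal scale N" by blast
  then show ?thesis by simp
qed

end

section \<open>Polynomial families\<close>

text \<open>
  Polynomial functions of a complex variable with values in a free algebra, expanded in the
  Newton basis of binomial coefficients.  In this basis the coefficients are
  determined recursively by the values at the natural numbers.
\<close>

inductive_set newton_family :: "(complex \<Rightarrow> 'g fa) set" where
  base: "(\<lambda>c. scal (c gchoose k) * p) \<in> newton_family"
| add: "f \<in> newton_family \<Longrightarrow> g \<in> newton_family \<Longrightarrow> (\<lambda>c. f c + g c) \<in> newton_family"

lemma newton_const: "(\<lambda>c. p) \<in> newton_family"
  using newton_family.base[of 0 p] by simp

lemma newton_mult_const: "f \<in> newton_family \<Longrightarrow> (\<lambda>c. p * f c) \<in> newton_family"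
proof (induction rule: newton_family.induct)
  case (base k q)
  show ?case using newton_family.base[of k "p * q"] by (simp add: scal_left_commute)
next
  case (add f g)
  from newton_family.add[OF add.IH] show ?case by (simp add: distrib_left)
qed

lemma newton_times_c: "f \<in> newton_family \<Longrightarrow> (\<lambda>c. scal c * f c) \<in> newton_family"
proof (induction rule: newton_family.induct)
  case (base k p)
  have "scal c * (scal (c gchoose k) * p) = scal (c gchoose k) * (scal (of_nat k) * p) +
      scal (c gchoose Suc k) * (scal (of_nat (Suc k)) * p)" for c
    unfolding mult.assoc[symmetric] scal_mult[symmetric] gbinomial_mult_1
    by (simp add: single_add distrib_right mult.commute)
  then show ?case
    using newton_family.add[OF newton_family.base[of k] newton_family.base[of "Suc k"]] by simp
next
  case (add f g)
  from newton_family.add[OF add.IH] show ?case by (simp add: distrib_left)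
qed

lemma newton_times_gchoose:
  assumes "f \<in> newton_family"
  shows "(\<lambda>c. scal (c gchoose k) * f c) \<in> newton_family"
proof (induction k)
  case 0
  show ?case using assms by simp
next
  case (Suc k)
  have "c gchoose Suc k = (1 / of_nat (Suc k)) * (c * (c gchoose k)) +
      (- of_nat k / of_nat (Suc k)) * (c gchoose k)" for c :: complex
    unfolding gbinomial_mult_1 using of_nat_neq_0[of k, where 'a = complex]
    by (simp add: field_simps del: of_nat_Suc)
  then have "scal (c gchoose Suc k) * f c =
      scal (1 / of_nat (Suc k)) * (scal c * (scal (c gchoose k) * f c)) +
      scal (- of_nat k / of_nat (Suc k)) * (scal (c gchoose k) * f c)" for c
    by (simp only: single_add distrib_right scal_mult mult.assoc)
  then show ?case
    using newton_family.add[OF newton_mult_const[OF newton_times_c[OF Suc]] newton_mult_const[OF Suc]]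
    by simp
qed

lemma newton_mult:
  assumes "f \<in> newton_family" "g \<in> newton_family"
  shows "(\<lambda>c. f c * g c) \<in> newton_family"
  using assms
proof (induction rule: newton_family.induct)
  case (base k p)
  from newton_times_gchoose[OF newton_mult_const[OF base], of k p]
  show ?case by (simp add: mult.assoc)
next
  case (add f h)
  from newton_family.add[OF add.IH(1)[OF add.prems] add.IH(2)[OF add.prems]]
  show ?case by (simp add: distrib_right)
qed

lemma newton_form:
  assumes "f \<in> newton_family"
  shows "\<exists>q m. \<forall>M\<ge>m. \<forall>c. f c = (\<Sum>k<M. scal (c gchoose k) * q k)"
  using assms
proof (induction rule: newton_family.induct)
  case (base k p)
  show ?case
  proof (intro exI allI impI)
    fix M c assume "Suc k \<le> M"
    then show "scal (c gchoose k) * p = (\<Sum>l<M. scal (c gchoose l) * (if l = k then p else 0))"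
      by (simp add: if_distrib[of "\<lambda>x. _ * x"] sum.delta cong: if_cong)
  qed
next
  case (add f g)
  then obtain q m q' m' where "\<forall>M\<ge>m. \<forall>c. f c = (\<Sum>k<M. scal (c gchoose k) * q k)"
    "\<forall>M\<ge>m'. \<forall>c. g c = (\<Sum>k<M. scal (c gchoose k) * q' k)" by blast
  then have "f c + g c = (\<Sum>k<M. scal (c gchoose k) * (q k + q' k))" if "max m m' \<le> M" for M c
    unfolding distrib_left sum.distrib using that by (intro arg_cong2[where f = "(+)"]) simp_all
  then have "\<forall>M\<ge>max m m'. \<forall>c. f c + g c = (\<Sum>k<M. scal (c gchoose k) * (q k + q' k))" by blast
  then show ?case by (rule exI[of _ "\<lambda>k. q k + q' k", OF exI[of _ "max m m'"]])
qed

lemma (in subalgebra_ideal) newton_family_vanish: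
  assumes f: "f \<in> newton_family" and nat: "\<And>n. f (of_nat n) \<in> I"
  shows "f c \<in> I"
proof -
  from newton_form[OF f] obtain q m
    where f_eq: "\<And>M c. m \<le> M \<Longrightarrow> f c = (\<Sum>k<M. scal (c gchoose k) * q k)" by blast
  have "q n \<in> I" for n
  proof (induction n rule: less_induct)
    case (less n)
    let ?g = "\<lambda>k. scal (of_nat n gchoose k) * q k"
    have "of_nat n gchoose k = (0 :: complex)" if "n < k" for k
      using that by (metis binomial_eq_0 binomial_gbinomial of_nat_0)
    then have "f (of_nat n) = sum ?g {..<Suc n}"
      unfolding f_eq[OF max.cobounded1, of "of_nat n" "Suc n"]
      by (intro sum.mono_neutral_right) auto
    also have "\<dots> = sum ?g {..<n} + q n"
      by (simp add: binomial_gbinomial[symmetric])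
    finally have "q n = f (of_nat n) - sum ?g {..<n}" by simp
    also have "\<dots> \<in> I"
      using less by (intro diff_I nat sum_I scal_I) simp
    finally show ?case .
  qed
  then show ?thesis
    unfolding f_eq[OF order_refl] by (intro sum_I scal_I)
qed

lemma newton_merge_sum: "(\<lambda>c. merge_sum (a - c) f xs) \<in> newton_family"
proof (induction "length xs" arbitrary: xs f rule: less_induct)
  case less
  consider "xs = []" | x where "xs = [x]" | x y ys where "xs = x # y # ys"
    by (cases xs; cases "tl xs") auto
  then show ?case
  proof cases
    case 3
    have "(\<lambda>c. scal (c gchoose 0) * scal a + scal (c gchoose 1) * scal (-1)) \<in> newton_family"
      by (intro newton_family.add newton_family.base)
    then have "(\<lambda>c. scal (a - c)) \<in> newton_family"
      by (simp add: mult_single single_add[symmetric])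
    from newton_mult[OF this less[of "x * y # ys" f]]
    show ?thesis unfolding 3 merge_sum.simps
      by (intro newton_family.add less) (simp_all add: 3)
  qed (simp_all add: newton_const)
qed

section \<open>Families of noncommutative polynomials in the shifted generators\<close>

text \<open>
  A noncommutative polynomial in the generators is encoded by the function that maps \<open>N\<close> and \<open>c\<close>
  to a representative of its value at the generators \<open>t\<^bsub>ij\<^esub>(x;N;s+c)\<close>.
\<close>

inductive_set shift_family :: "nat \<Rightarrow> complex \<Rightarrow> (nat \<Rightarrow> complex \<Rightarrow> ('w::ring) mat fa) set"
  for d :: nat and s :: complex where
  one: "(\<lambda>N c. 1) \<in> shift_family d s"
| gen: "i \<in> {1..d} \<Longrightarrow> j \<in> {1..d} \<Longrightarrow> xs \<noteq> [] \<Longrightarrow>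
    (\<lambda>N c. merge_sum (- of_nat N - s - c) (e_poly N j i) xs) \<in> shift_family d s"
| add: "P \<in> shift_family d s \<Longrightarrow> R \<in> shift_family d s \<Longrightarrow>
    (\<lambda>N c. P N c + R N c) \<in> shift_family d s"
| mult: "P \<in> shift_family d s \<Longrightarrow> R \<in> shift_family d s \<Longrightarrow>
    (\<lambda>N c. P N c * R N c) \<in> shift_family d s"
| scal: "P \<in> shift_family d s \<Longrightarrow> (\<lambda>N c. scal a * P N c) \<in> shift_family d s"

context complex_algebra
begin

lemma shift_family_newton: "P \<in> shift_family d s \<Longrightarrow> (\<lambda>c. P N c) \<in> newton_family"
  by (induction rule: shift_family.induct)
    (simp_all add: newton_const newton_merge_sum newton_family.add newton_mult newton_mult_const)

lemma shift_family_in_free: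
  fixes P :: "nat \<Rightarrow> complex \<Rightarrow> 'w mat fa"
  assumes "P \<in> shift_family d s" "d \<le> N"
  shows "P N c \<in> carrier (free_alg (gl N))"
proof -
  interpret gl_level scale N by unfold_locales
  have m: "merge_sum z f xs \<in> carrier (free_alg (gl N))"
    if "\<And>l. f l \<in> carrier (free_alg (gl N))" for z and f :: "'w list \<Rightarrow> 'w mat fa" and xs
    using that by (induction z f xs rule: merge_sum.induct)
      (simp_all add: lower.add_C lower.mult_C lower.scal_C)
  show ?thesis
    using assms(1)
  proof (induction rule: shift_family.induct)
    case (gen i j xs)
    show ?case by (rule m, rule e_poly_in_free) (use gen assms(2) in auto)
  qed (simp_all add: lower.one_C lower.add_C lower.mult_C lower.scal_C)
qed

text \<open>
  Modulo the ideal, the projection from level \<open>N + 1\<close> to level \<open>N\<close> increases the shift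
  parameter by 1, and it is multiplicative on these families.
\<close>

lemma Phi_mult_shift_family:
  fixes N
  assumes "P \<in> shift_family d s" "d \<le> N"
  defines "F \<equiv> linear_ext (tri_word (corner N) (\<lambda>x. gl_bracket (Suc N) (last_row (Suc N) x)))"
  shows "F (p * P (Suc N) c) - F p * P N (c + 1) \<in> U_ideal scale N"
proof -
  interpret gl_level scale N by unfold_locales
  have "lower.cong (lower.\<Phi> (p * P (Suc N) c)) (lower.\<Phi> p * P N (c + 1))" for p
    using assms(1)
  proof (induction arbitrary: p rule: shift_family.induct)
    case (gen i j xs)
    \<comment> \<open>The coefficients depend on the level and on the shift only through their sum.\<close>
    have "- of_nat (Suc N) - s - c = - of_nat N - s - (c + 1)" by simp
    then show ?case
      by (simp only:) (rule Phi_mult_merge_sum, use gen assms(2) in \<open>auto intro!: Phi_mult_e_poly(2)\<close>)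
  next
    case (add P R)
    from lower.cong_add[OF add.IH] show ?case by (simp add: distrib_left linear_ext_add)
  next
    case (mult P R)
    have "lower.cong (lower.\<Phi> (p * P (Suc N) c * R (Suc N) c)) (lower.\<Phi> (p * P (Suc N) c) * R N (c + 1))"
      by (rule mult.IH)
    also have "lower.cong \<dots> (lower.\<Phi> p * P N (c + 1) * R N (c + 1))"
      by (intro lower.cong_right mult.IH shift_family_in_free[OF mult.hyps(2) assms(2)])
    finally show ?case by (simp add: mult.assoc)
  next
    case (scal P a)
    from lower.cong_scal[OF scal.IH, of a p] show ?case
      by (simp only: scal_left_commute linear_ext_scal)
  qed simp
  then show ?thesis by (simp add: F_def lower.cong_def)
qed

lemma merge_sum_family:
  assumes "xs \<noteq> []" "\<And>l. l \<noteq> [] \<Longrightarrow> f l \<in> shift_family d s"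
  shows "(\<lambda>N c. merge_sum w (\<lambda>l. f l N c) xs) \<in> shift_family d s"
  using assms
proof (induction "length xs" arbitrary: xs f rule: less_induct)
  case less
  consider x where "xs = [x]" | x y ys where "xs = x # y # ys"
    using less.prems(1) by (cases xs; cases "tl xs") auto
  then show ?case
  proof cases
    case 1
    then show ?thesis using less.prems(2)[of xs] by simp
  next
    case 2
    show ?thesis unfolding 2 merge_sum.simps
      by (intro shift_family.add shift_family.scal less.hyps less.prems) (simp_all add: 2)
  qed
qed

lemma shift_family_shift:
  "P \<in> shift_family d s \<Longrightarrow> (\<lambda>N c. P N (c + c')) \<in> shift_family d s"
proof (induction rule: shift_family.induct)
  case (gen i j xs)
  have "merge_sum (- of_nat N - s - (c + c')) (e_poly N j i) xs =
      merge_sum (- c') (\<lambda>l. merge_sum (- of_nat N - s - c) (e_poly N j i) l) xs" for N c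
  proof -
    have "- c' + (- of_nat N - s - c) = - of_nat N - s - (c + c')" by simp
    then show ?thesis using merge_sum_merge_sum[OF gen(3), of "- c'" "- of_nat N - s - c" "e_poly N j i"]
      by metis
  qed
  moreover have "(\<lambda>N c. merge_sum (- c') (\<lambda>l. merge_sum (- of_nat N - s - c) (e_poly N j i) l) xs)
      \<in> shift_family d s"
    by (rule merge_sum_family[OF gen(3), where f = "\<lambda>l N c. merge_sum (- of_nat N - s - c) (e_poly N j i) l"])
      (rule shift_family.gen[OF gen(1,2)])
  ultimately show ?case by (simp only:)
next
  case (add P R)
  show ?case by (rule shift_family.add[OF add.IH])
next
  case (mult P R)
  show ?case by (rule shift_family.mult[OF mult.IH])
next
  case (scal P a)
  show ?case by (rule shift_family.scal[OF scal.IH])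
qed (rule shift_family.one)

text \<open>
  A relation at \<open>c = 0\<close> that holds at all levels is projected down to relations at all natural
  numbers \<open>c\<close>; by polynomiality it holds for all \<open>c\<close>.
\<close>

lemma shift_family_vanish:
  assumes P: "P \<in> shift_family d s" and 0: "\<And>N. d \<le> N \<Longrightarrow> P N 0 \<in> U_ideal scale N"
    and N: "d \<le> N"
  shows "P N c \<in> U_ideal scale N"
proof -
  have "P N (of_nat n) \<in> U_ideal scale N" if "d \<le> N" for n N
    using that
  proof (induction n arbitrary: N)
    case 0
    then show ?case using assms(2) by simp
  next
    case (Suc n)
    interpret gl_level scale N by unfold_locales
    have "lower.\<Phi> (P (Suc N) (of_nat n)) \<in> U_ideal scale N"
      using Suc.prems by (intro Phi_U_ideal Suc.IH) simp
    then have "lower.cong (lower.\<Phi> (1 * P (Suc N) (of_nat n))) 0"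
      by (simp only: lower.cong_0_iff mult_1)
    moreover have "lower.cong (lower.\<Phi> (1 * P (Suc N) (of_nat n))) (lower.\<Phi> 1 * P N (of_nat n + 1))"
      unfolding lower.cong_def by (rule Phi_mult_shift_family[OF P Suc.prems])
    ultimately have "lower.cong (lower.\<Phi> 1 * P N (of_nat n + 1)) 0"
      by - (rule lower.cong_trans[OF lower.cong_sym])
    moreover have "lower.\<Phi> 1 = 1"
      using linear_ext_word_mon[of lower.\<phi> "[]"] by (simp only: word_mon_Nil tri_word.simps)
    moreover have "of_nat n + 1 = (of_nat (Suc n) :: complex)" by simp
    ultimately show ?case by (simp only: lower.cong_0_iff mult_1)
  qed
  then have nat: "P N (of_nat n) \<in> U_ideal scale N" for n
    using N by blast
  interpret gl_level scale N by unfold_locales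
  show ?thesis
    by (rule lower.newton_family_vanish[where f = "P N", OF shift_family_newton[OF P] nat])
qed

section \<open>The shift automorphisms\<close>

text \<open>The sequence of elements of the enveloping algebras represented by a family at \<open>c\<close>.\<close>

definition family_value :: "nat \<Rightarrow> (nat \<Rightarrow> complex \<Rightarrow> 'w mat fa) \<Rightarrow> complex \<Rightarrow> nat \<Rightarrow> 'w U_elem" where
  "family_value d P c = (\<lambda>N\<in>{d..}. U_ideal scale N +>\<^bsub>free_alg (gl N)\<^esub> P N c)"

lemma family_value_eq:
  assumes "P \<in> shift_family d s" "R \<in> shift_family d s" "family_value d P 0 = family_value d R 0"
  shows "family_value d P c = family_value d R c"
proof -
  let ?D = "\<lambda>N c. P N c + scal (-1) * R N c"
  have D: "?D \<in> shift_family d s" by (rule shift_family.add[OF assms(1) shift_family.scal[OF assms(2)]])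
  have eq: "(family_value d P c N = family_value d R c N) \<longleftrightarrow> ?D N c \<in> U_ideal scale N"
    if "d \<le> N" for N c
  proof -
    interpret gl_level scale N by unfold_locales
    show ?thesis using that lower.cl_eq_iff[of "P N c" "R N c"]
      by (simp add: family_value_def lower.cl_def lower.cong_def single_uminus)
  qed
  have "family_value d P c N = family_value d R c N" for N
  proof (cases "d \<le> N")
    case True
    have "?D N 0 \<in> U_ideal scale N" if "d \<le> N" for N
      using eq[OF that, of 0] assms(3) by simp
    from shift_family_vanish[OF D this True] show ?thesis using eq[OF True] by simp
  qed (simp add: family_value_def)
  then show ?thesis by blast
qed

lemma family_value_ops:
  assumes "P \<in> shift_family d s" "R \<in> shift_family d s"
  shows "family_value d P c \<otimes>\<^bsub>A_lim scale d\<^esub> family_value d R c = family_value d (\<lambda>N c. P N c * R N c) c"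
    and "family_value d P c \<oplus>\<^bsub>A_lim scale d\<^esub> family_value d R c = family_value d (\<lambda>N c. P N c + R N c) c"
    and "a \<odot>\<^bsub>A_lim scale d\<^esub> family_value d P c = family_value d (\<lambda>N c. scal a * P N c) c"
    and "\<one>\<^bsub>A_lim scale d\<^esub> = family_value d (\<lambda>N c. 1) c"
proof -
  have *: "(U_ideal scale N +>\<^bsub>free_alg (gl N)\<^esub> P N c) \<otimes>\<^bsub>U scale N\<^esub> (U_ideal scale N +>\<^bsub>free_alg (gl N)\<^esub> R N c)
      = U_ideal scale N +>\<^bsub>free_alg (gl N)\<^esub> (P N c * R N c) \<and>
    (U_ideal scale N +>\<^bsub>free_alg (gl N)\<^esub> P N c) \<oplus>\<^bsub>U scale N\<^esub> (U_ideal scale N +>\<^bsub>free_alg (gl N)\<^esub> R N c)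
      = U_ideal scale N +>\<^bsub>free_alg (gl N)\<^esub> (P N c + R N c) \<and>
    a \<odot>\<^bsub>U scale N\<^esub> (U_ideal scale N +>\<^bsub>free_alg (gl N)\<^esub> P N c)
      = U_ideal scale N +>\<^bsub>free_alg (gl N)\<^esub> (scal a * P N c) \<and>
    \<one>\<^bsub>U scale N\<^esub> = U_ideal scale N +>\<^bsub>free_alg (gl N)\<^esub> 1" if "d \<le> N" for N
  proof -
    interpret gl_level scale N by unfold_locales
    note free = assms[THEN shift_family_in_free, OF that, of c]
    show ?thesis
      using lower.cl_mult[OF free] lower.cl_add[OF free] lower.cl_smult[of a "P N c"] lower.cl_one
      by (simp add: U_eq lower.cl_def)
  qed
  show "family_value d P c \<otimes>\<^bsub>A_lim scale d\<^esub> family_value d R c = family_value d (\<lambda>N c. P N c * R N c) c"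
    and "family_value d P c \<oplus>\<^bsub>A_lim scale d\<^esub> family_value d R c = family_value d (\<lambda>N c. P N c + R N c) c"
    and "a \<odot>\<^bsub>A_lim scale d\<^esub> family_value d P c = family_value d (\<lambda>N c. scal a * P N c) c"
    and "\<one>\<^bsub>A_lim scale d\<^esub> = family_value d (\<lambda>N c. 1) c"
    using * by (auto simp: A_lim_def family_value_def intro!: restrict_ext)
qed

lemma family_value_gen:
  assumes "i \<in> {1..d}" "j \<in> {1..d}" "xs \<noteq> []"
  shows "family_value d (\<lambda>N c. merge_sum (- of_nat N - s - c) (e_poly N j i) xs) c
    = t_gen scale d (s + c) i j xs"
  unfolding family_value_def t_gen_def
proof (rule restrict_ext)
  fix N assume "N \<in> {d..}"
  then have ij: "i \<in> {1..N}" "j \<in> {1..N}" using assms by auto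
  interpret gl_level scale N by unfold_locales
  show "U_ideal scale N +>\<^bsub>free_alg (gl N)\<^esub> merge_sum (- of_nat N - s - c) (e_poly N j i) xs
    = t_level scale N (s + c) i j xs"
    unfolding t_level_eq[OF ij assms(3)] by (simp add: lower.cl_def diff_diff_eq)
qed

lemma carrier_Y: "carrier (Y scale d s) = (\<lambda>P. family_value d P 0) ` shift_family d s"
proof -
  let ?S = "{t_gen scale d s i j xs | i j xs. i \<in> {1..d} \<and> j \<in> {1..d} \<and> xs \<in> tuples}"
  let ?V = "(\<lambda>P. family_value d P 0) ` shift_family d s"
  have V: "family_value d P 0 \<in> ?V" if "P \<in> shift_family d s" for P
    using that by (rule imageI)
  have value_one: "\<one>\<^bsub>A_lim scale d\<^esub> = family_value d (\<lambda>N c. 1) 0"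
    by (rule family_value_ops(4)[OF shift_family.one shift_family.one])
  have value_gen: "family_value d (\<lambda>N c. merge_sum (- of_nat N - s - c) (e_poly N j i) xs) 0
      = t_gen scale d s i j xs" if "i \<in> {1..d}" "j \<in> {1..d}" "xs \<noteq> []" for i j xs
    using family_value_gen[OF that, of s 0] by simp
  have "a \<in> ?V" if "a \<in> generate_algebra (A_lim scale d) ?S" for a
    using that
  proof (induction rule: generate_algebra.induct)
    case one
    show ?case unfolding value_one by (rule V[OF shift_family.one])
  next
    case (incl a)
    then obtain i j xs where a: "a = t_gen scale d s i j xs"
      and ij: "i \<in> {1..d}" "j \<in> {1..d}" "xs \<noteq> []"
      by (auto simp: tuples_def)
    show ?case unfolding a value_gen[OF ij, symmetric] by (rule V[OF shift_family.gen[OF ij]])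
  next
    case (add a b)
    then obtain P R where P: "P \<in> shift_family d s" and R: "R \<in> shift_family d s"
      and ab: "a = family_value d P 0" "b = family_value d R 0" by blast
    show ?case unfolding ab family_value_ops(2)[OF P R] by (rule V[OF shift_family.add[OF P R]])
  next
    case (mult a b)
    then obtain P R where P: "P \<in> shift_family d s" and R: "R \<in> shift_family d s"
      and ab: "a = family_value d P 0" "b = family_value d R 0" by blast
    show ?case unfolding ab family_value_ops(1)[OF P R] by (rule V[OF shift_family.mult[OF P R]])
  next
    case (smult a z)
    then obtain P where P: "P \<in> shift_family d s" and a: "a = family_value d P 0" by blast
    show ?case unfolding a family_value_ops(3)[OF P P] by (rule V[OF shift_family.scal[OF P]])
  qed
  moreover have "family_value d P 0 \<in> generate_algebra (A_lim scale d) ?S"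
    if "P \<in> shift_family d s" for P
    using that
  proof (induction rule: shift_family.induct)
    case one
    show ?case unfolding value_one[symmetric] by (rule generate_algebra.one)
  next
    case (gen i j xs)
    have "t_gen scale d s i j xs \<in> ?S" using gen.hyps unfolding tuples_def by blast
    then show ?case unfolding value_gen[OF gen.hyps]
      by (rule generate_algebra.incl)
  next
    case (add P R)
    show ?case unfolding family_value_ops(2)[OF add.hyps, symmetric]
      by (rule generate_algebra.add[OF add.IH])
  next
    case (mult P R)
    show ?case unfolding family_value_ops(1)[OF mult.hyps, symmetric]
      by (rule generate_algebra.mult[OF mult.IH])
  next
    case (scal P z)
    show ?case unfolding family_value_ops(3)[OF scal.hyps scal.hyps, symmetric]
      by (rule generate_algebra.smult[OF scal.IH])
  qed
  ultimately have "generate_algebra (A_lim scale d) ?S = ?V" by blast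
  then show ?thesis by (simp add: Y_def)
qed

text \<open>
  The element \<open>a\<close> is written as a polynomial in the generators \<open>t\<^bsub>ij\<^esub>(x;s)\<close>, and the polynomial is then evaluated
  at \<open>t\<^bsub>ij\<^esub>(x;s+c)\<close>.  The result does not depend on the choice of the polynomial, by \<open>family_value_eq\<close>.
\<close>

definition shift :: "nat \<Rightarrow> complex \<Rightarrow> complex \<Rightarrow> (nat \<Rightarrow> 'w U_elem) \<Rightarrow> (nat \<Rightarrow> 'w U_elem)" where
  "shift d s c = (\<lambda>a\<in>carrier (Y scale d s).
    family_value d (SOME P. P \<in> shift_family d s \<and> family_value d P 0 = a) c)"

lemma shift_family_value:
  assumes "P \<in> shift_family d s"
  shows "shift d s c (family_value d P 0) = family_value d P c"
proof -
  let ?R = "SOME R. R \<in> shift_family d s \<and> family_value d R 0 = family_value d P 0"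
  have "?R \<in> shift_family d s \<and> family_value d ?R 0 = family_value d P 0"
    by (rule someI[of "\<lambda>R. R \<in> shift_family d s \<and> family_value d R 0 = family_value d P 0" P])
      (use assms in simp)
  then have "family_value d ?R c = family_value d P c"
    using family_value_eq assms by blast
  moreover have "family_value d P 0 \<in> carrier (Y scale d s)"
    using assms by (simp add: carrier_Y)
  ultimately show ?thesis by (simp add: shift_def)
qed

lemma family_value_shift:
  "family_value d (\<lambda>N c. P N (c + c')) c = family_value d P (c + c')"
  by (simp add: family_value_def)

lemma shift_in_Y:
  assumes "a \<in> carrier (Y scale d s)"
  shows "shift d s c a \<in> carrier (Y scale d s)"
proof -
  obtain P where P: "P \<in> shift_family d s" and a: "a = family_value d P 0"
    using assms unfolding carrier_Y by blast
  show ?thesis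
    using shift_family_shift[OF P, of c] family_value_shift[of d P c 0]
    by (auto simp: a shift_family_value[OF P] carrier_Y intro: image_eqI[OF sym])
qed

lemma shift_shift:
  assumes "a \<in> carrier (Y scale d s)"
  shows "shift d s c (shift d s c' a) = shift d s (c + c') a"
proof -
  obtain P where P: "P \<in> shift_family d s" and a: "a = family_value d P 0"
    using assms unfolding carrier_Y by blast
  show ?thesis
    using shift_family_value[OF shift_family_shift[OF P, of c'], of c]
    by (simp add: a shift_family_value[OF P] family_value_shift)
qed

lemma shift_zero: "a \<in> carrier (Y scale d s) \<Longrightarrow> shift d s 0 a = a"
  by (auto simp: carrier_Y shift_family_value)

lemma shift_bij: "bij_betw (shift d s c) (carrier (Y scale d s)) (carrier (Y scale d s))"
  by (rule bij_betw_byWitness[where f' = "shift d s (- c)"])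
    (auto simp: shift_in_Y shift_shift shift_zero)

lemma Y_ops:
  "mult (Y scale d s) = mult (A_lim scale d)" "one (Y scale d s) = one (A_lim scale d)"
  "add (Y scale d s) = add (A_lim scale d)" "smult (Y scale d s) = smult (A_lim scale d)"
  by (simp_all add: Y_def)

lemma shift_auto: "shift d s c \<in> algebra_auto (Y scale d s)"
proof -
  have "shift d s c (a \<otimes>\<^bsub>Y scale d s\<^esub> b) = shift d s c a \<otimes>\<^bsub>Y scale d s\<^esub> shift d s c b \<and>
    shift d s c (a \<oplus>\<^bsub>Y scale d s\<^esub> b) = shift d s c a \<oplus>\<^bsub>Y scale d s\<^esub> shift d s c b \<and>
    shift d s c (z \<odot>\<^bsub>Y scale d s\<^esub> a) = z \<odot>\<^bsub>Y scale d s\<^esub> shift d s c a"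
    if ab: "a \<in> carrier (Y scale d s)" "b \<in> carrier (Y scale d s)" for a b z
  proof -
    obtain P where P: "P \<in> shift_family d s" and a: "a = family_value d P 0"
      using ab(1) unfolding carrier_Y by blast
    obtain R where R: "R \<in> shift_family d s" and b: "b = family_value d R 0"
      using ab(2) unfolding carrier_Y by blast
    show ?thesis
      unfolding a b Y_ops shift_family_value[OF P] shift_family_value[OF R] family_value_ops[OF P R]
      using shift_family_value[OF shift_family.mult[OF P R]]
        shift_family_value[OF shift_family.add[OF P R]]
        shift_family_value[OF shift_family.scal[OF P]] by blast
  qed
  moreover have "shift d s c \<one>\<^bsub>Y scale d s\<^esub> = \<one>\<^bsub>Y scale d s\<^esub>"
  proof -
    have one: "\<one>\<^bsub>Y scale d s\<^esub> = family_value d (\<lambda>N c. 1) z" for z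
      unfolding Y_ops(2) by (rule family_value_ops(4)[OF shift_family.one shift_family.one])
    show ?thesis
      using shift_family_value[OF shift_family.one, of d s c] by (simp only: one[of 0, symmetric] one[of c, symmetric])
  qed
  ultimately show ?thesis
    by (auto simp: algebra_auto_def ring_iso_def ring_hom_def shift_in_Y shift_bij)
qed

lemma shift_action: "group_action complex_add_group (carrier (Y scale d s)) (shift d s)"
proof -
  have "Group.group complex_add_group"
  proof (rule groupI)
    fix x assume "x \<in> carrier complex_add_group"
    show "\<exists>y\<in>carrier complex_add_group. y \<otimes>\<^bsub>complex_add_group\<^esub> x = \<one>\<^bsub>complex_add_group\<^esub>"
      by (rule bexI[of _ "- x"]) (simp_all add: complex_add_group_def)
  qed (simp_all add: complex_add_group_def)
  moreover have Bij: "shift d s c \<in> Bij (carrier (Y scale d s))" for c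
    unfolding Bij_def using shift_bij by (simp add: shift_def)
  moreover have "shift d s (c + c') = compose (carrier (Y scale d s)) (shift d s c) (shift d s c')"
    for c c'
  proof
    fix a
    show "shift d s (c + c') a = compose (carrier (Y scale d s)) (shift d s c) (shift d s c') a"
    proof (cases "a \<in> carrier (Y scale d s)")
      case True
      then show ?thesis by (simp add: compose_def shift_shift)
    next
      case False
      then show ?thesis by (simp add: compose_def shift_def)
    qed
  qed
  ultimately have "shift d s \<in> hom complex_add_group (BijGroup (carrier (Y scale d s)))"
    by (simp add: hom_def BijGroup_def complex_add_group_def)
  with \<open>Group.group complex_add_group\<close> show ?thesis
    by (simp add: group_action_def group_hom_def group_hom_axioms_def group_BijGroup)
qed

lemma shift_t_gen:
  assumes "i \<in> {1..d}" "j \<in> {1..d}" "xs \<in> tuples"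
  shows "shift d s0 c (t_gen scale d s i j xs) = t_gen scale d (s + c) i j xs"
proof -
  let ?P = "\<lambda>N c. merge_sum (- of_nat N - s0 - c) (e_poly N j i) xs"
  have xs: "xs \<noteq> []" using assms(3) by (simp add: tuples_def)
  let ?R = "\<lambda>N c. ?P N (c + (s - s0))"
  have R: "?R \<in> shift_family d s0"
    by (intro shift_family_shift shift_family.gen assms xs)
  have "family_value d ?R c = t_gen scale d (s + c) i j xs" for c
    unfolding family_value_shift[of d ?P] family_value_gen[OF assms(1,2) xs] by (simp add: algebra_simps)
  from this[of c] this[of 0] shift_family_value[OF R, of c] show ?thesis by simp
qed

end

theorem theorem4p4:
  fixes scale :: "complex \<Rightarrow> 'w::ring \<Rightarrow> 'w"
    and B :: "'w set"
    and d :: nat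
    and s0 :: complex
  assumes "complex_algebra scale"
    and "countable B" "\<not> module.dependent scale B" "module.span scale B = UNIV"
    and "d \<ge> 1"
  shows "\<exists>Shift :: complex \<Rightarrow> (nat \<Rightarrow> 'w U_elem) \<Rightarrow> (nat \<Rightarrow> 'w U_elem).
    group_action complex_add_group (carrier (Y scale d s0)) Shift \<and>
    (\<forall>c. Shift c \<in> algebra_auto (Y scale d s0)) \<and>
    (\<forall>c s. \<forall>i\<in>{1..d}. \<forall>j\<in>{1..d}. \<forall>xs\<in>tuples.
      Shift c (t_gen scale d s i j xs) = t_gen scale d (s + c) i j xs)"
proof -
  interpret complex_algebra scale by (rule assms(1))
  show ?thesis
    using shift_action shift_auto shift_t_gen by (intro exI[of _ "shift d s0"]) blast
qed

end
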